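(* Let $k$ be a field, let $G$ be a finite group and let $\mathcal{C}\to\mathcal{B}$ be a smash extension of $k$-categories with group $G$, that is, $\mathcal{C}$ is a $kG$-module category and $\mathcal{B}=\mathcal{C}\# kG$. Let $I_G\mathcal{C}\to (I_G\mathcal{C})/G$ be the corresponding Galois covering. Then $I_G\mathcal{C}$ is equivalent to $\mathcal{C}$, and $(I_G\mathcal{C})/G$ is equivalent to $\mathcal{B}$.
   Context: A $k$-category is a category whose objects form a set $\mathcal{C}_0$, whose morphism sets ${}_y\mathcal{C}_x$ (from $x$ to $y$) are $k$-vector spaces, and whose composition is $k$-bilinear. Functors and equivalences between $k$-categories are understood to be $k$-linear. A $kG$-module category is a $k$-category $\mathcal{C}$ in which each ${}_y\mathcal{C}_x$ is a $kG$-module, with $s(gf)=s(g)s(f)$ for composable morphisms $g,f$ and $s(1_x)=1_x$ for all $s\in G$ and all objects $x$. The smash category $\mathcal{C}\# kG$ has the same objects as $\mathcal{C}$, morphisms ${}_y(\mathcal{C}\# kG)_x={}_y\mathcal{C}_x\otimes_k kG$, and composition $(g\otimes v)(f\otimes u)=g\,v(f)\otimes vu$ for $u,v\in G$. The smash extension is the functor $\mathcal{C}\to\mathcal{C}\# kG$ that is the identity on objects and $f\mapsto f\otimes 1$ on morphisms. The inflated category $I_G\mathcal{C}$ has set of objects $\mathcal{C}_0\times G$ and morphisms ${}_{(y,t)}(I_G\mathcal{C})_{(x,s)}={}_y\mathcal{C}_x$, with composition that of $\mathcal{C}$. The group $G$ acts on $I_G\mathcal{C}$ by $u(x,s)=(x,us)$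 on objects, and by sending $f\in{}_y\mathcal{C}_x={}_{(y,t)}(I_G\mathcal{C})_{(x,s)}$ to $u(f)\in{}_y\mathcal{C}_x={}_{(y,ut)}(I_G\mathcal{C})_{(x,us)}$ on morphisms; this action is free on objects. For a $k$-category $\mathcal{D}$ with a $G$-action (by $k$-linear automorphisms of the category) which is free on objects, the quotient $\mathcal{D}/G$ has as objects the $G$-orbits of objects, with morphisms ${}_\beta(\mathcal{D}/G)_\alpha=\left(\bigoplus_{b\in\beta,a\in\alpha}{}_b\mathcal{D}_a\right)/G$, where $X/G$ denotes the coinvariants of a $kG$-module $X$. For $g\in{}_d\mathcal{D}_c$ and $f\in{}_b\mathcal{D}_a$ with $c=sb$ ($s\in G$), composition is $[g][f]=[g\,(sf)]$. The projection functor $\mathcal{D}\to\mathcal{D}/G$ is the corresponding Galois covering. *)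

theory Defs
  imports "HOL-Algebra.Module" "HOL-Algebra.AbelCoset" "HOL-Algebra.Group_Action"
begin

section \<open>Linear algebra over a ring \<open>K\<close>\<close>

text \<open>Modules are the records of HOL-Algebra. Their \<open>mult\<close> and \<open>one\<close> fields play no role
  and are left unspecified in the constructions below.\<close>

definition linear_map ::
    "('k, 'r) ring_scheme \<Rightarrow> ('k, 'a, 's) module_scheme \<Rightarrow> ('k, 'b, 't) module_scheme \<Rightarrow> ('a \<Rightarrow> 'b) \<Rightarrow> bool"
  where "linear_map K V W f \<longleftrightarrow>
    f \<in> carrier V \<rightarrow> carrier W \<and>
    (\<forall>x\<in>carrier V. \<forall>y\<in>carrier V. f (x \<oplus>\<^bsub>V\<^esub> y) = f x \<oplus>\<^bsub>W\<^esub> f y) \<and>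
    (\<forall>c\<in>carrier K. \<forall>x\<in>carrier V. f (c \<odot>\<^bsub>V\<^esub> x) = c \<odot>\<^bsub>W\<^esub> f x)"

definition bilinear_map ::
    "('k, 'r) ring_scheme \<Rightarrow> ('k, 'a, 's) module_scheme \<Rightarrow> ('k, 'b, 't) module_scheme \<Rightarrow>
     ('k, 'c, 'u) module_scheme \<Rightarrow> ('a \<Rightarrow> 'b \<Rightarrow> 'c) \<Rightarrow> bool"
  where "bilinear_map K U V W h \<longleftrightarrow>
    (\<forall>x\<in>carrier U. linear_map K V W (h x)) \<and>
    (\<forall>y\<in>carrier V. linear_map K U W (\<lambda>x. h x y))"

definition direct_sum :: "'i set \<Rightarrow> ('i \<Rightarrow> ('k, 'a) module) \<Rightarrow> ('k, 'i \<Rightarrow> 'a) module"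
  where "direct_sum I M =
    \<lparr>carrier = {f \<in> (\<Pi>\<^sub>E i\<in>I. carrier (M i)). finite {i \<in> I. f i \<noteq> \<zero>\<^bsub>M i\<^esub>}},
     monoid.mult = undefined, one = undefined,
     zero = (\<lambda>i\<in>I. \<zero>\<^bsub>M i\<^esub>),
     add = (\<lambda>f g. \<lambda>i\<in>I. f i \<oplus>\<^bsub>M i\<^esub> g i),
     module.smult = (\<lambda>c f. \<lambda>i\<in>I. c \<odot>\<^bsub>M i\<^esub> f i)\<rparr>"

definition summand :: "'i set \<Rightarrow> ('i \<Rightarrow> ('k, 'a) module) \<Rightarrow> 'i \<Rightarrow> 'a \<Rightarrow> 'i \<Rightarrow> 'a"
  where "summand I M i x = (\<lambda>j\<in>I. if j = i then x else \<zero>\<^bsub>M j\<^esub>)"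

definition span_of :: "('k, 'r) ring_scheme \<Rightarrow> ('k, 'a) module \<Rightarrow> 'a set \<Rightarrow> 'a set"
  where "span_of K M S = \<Inter>{N. submodule N K M \<and> S \<subseteq> N}"

definition quotient_module :: "('k, 'a) module \<Rightarrow> 'a set \<Rightarrow> ('k, 'a set) module"
  where "quotient_module M N =
    \<lparr>carrier = a_rcosets\<^bsub>M\<^esub> N,
     monoid.mult = undefined, one = undefined,
     zero = N,
     add = (\<lambda>A B. A <+>\<^bsub>M\<^esub> B),
     module.smult = (\<lambda>c A. \<Union>a\<in>A. N +>\<^bsub>M\<^esub> (c \<odot>\<^bsub>M\<^esub> a))\<rparr>"

definition self_module :: "('k, 'r) ring_scheme \<Rightarrow> ('k, 'k) module"
  where "self_module K =
    \<lparr>carrier = carrier K, monoid.mult = monoid.mult K, one = one K, zero = zero K, add = add K,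
     module.smult = monoid.mult K\<rparr>"

definition free_module :: "('k, 'r) ring_scheme \<Rightarrow> 'i set \<Rightarrow> ('k, 'i \<Rightarrow> 'k) module"
  where "free_module K S = direct_sum S (\<lambda>_. self_module K)"

definition free_basis :: "('k, 'r) ring_scheme \<Rightarrow> 'i set \<Rightarrow> 'i \<Rightarrow> 'i \<Rightarrow> 'k"
  where "free_basis K S i = summand S (\<lambda>_. self_module K) i \<one>\<^bsub>K\<^esub>"

definition tensor_relations ::
    "('k, 'r) ring_scheme \<Rightarrow> ('k, 'a) module \<Rightarrow> ('k, 'b) module \<Rightarrow> ('a \<times> 'b \<Rightarrow> 'k) set"
  where "tensor_relations K V W =
    (let S = carrier V \<times> carrier W; F = free_module K S; e = free_basis K S in
      {e (v \<oplus>\<^bsub>V\<^esub> v', w) \<ominus>\<^bsub>F\<^esub> (e (v, w) \<oplus>\<^bsub>F\<^esub> e (v', w)) | v v' w.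
         v \<in> carrier V \<and> v' \<in> carrier V \<and> w \<in> carrier W} \<union>
      {e (v, w \<oplus>\<^bsub>W\<^esub> w') \<ominus>\<^bsub>F\<^esub> (e (v, w) \<oplus>\<^bsub>F\<^esub> e (v, w')) | v w w'.
         v \<in> carrier V \<and> w \<in> carrier W \<and> w' \<in> carrier W} \<union>
      {e (c \<odot>\<^bsub>V\<^esub> v, w) \<ominus>\<^bsub>F\<^esub> c \<odot>\<^bsub>F\<^esub> e (v, w) | c v w.
         c \<in> carrier K \<and> v \<in> carrier V \<and> w \<in> carrier W} \<union>
      {e (v, c \<odot>\<^bsub>W\<^esub> w) \<ominus>\<^bsub>F\<^esub> c \<odot>\<^bsub>F\<^esub> e (v, w) | c v w.
         c \<in> carrier K \<and> v \<in> carrier V \<and> w \<in> carrier W})"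

definition tensor_product ::
    "('k, 'r) ring_scheme \<Rightarrow> ('k, 'a) module \<Rightarrow> ('k, 'b) module \<Rightarrow> ('k, ('a \<times> 'b \<Rightarrow> 'k) set) module"
  where "tensor_product K V W =
    (let F = free_module K (carrier V \<times> carrier W)
     in quotient_module F (span_of K F (tensor_relations K V W)))"

definition pure_tensor ::
    "('k, 'r) ring_scheme \<Rightarrow> ('k, 'a) module \<Rightarrow> ('k, 'b) module \<Rightarrow> 'a \<Rightarrow> 'b \<Rightarrow> ('a \<times> 'b \<Rightarrow> 'k) set"
  where "pure_tensor K V W v w =
    (let S = carrier V \<times> carrier W; F = free_module K S
     in span_of K F (tensor_relations K V W) +>\<^bsub>F\<^esub> free_basis K S (v, w))"

text \<open>The underlying vector space of the group algebra \<open>kG\<close>; the element \<open>u\<close> of \<open>G\<close> is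
  identified with \<open>group_elem K G u\<close>.\<close>

definition group_space :: "('k, 'r) ring_scheme \<Rightarrow> ('g, 's) monoid_scheme \<Rightarrow> ('k, 'g \<Rightarrow> 'k) module"
  where "group_space K G = free_module K (carrier G)"

definition group_elem :: "('k, 'r) ring_scheme \<Rightarrow> ('g, 's) monoid_scheme \<Rightarrow> 'g \<Rightarrow> 'g \<Rightarrow> 'k"
  where "group_elem K G u = free_basis K (carrier G) u"

definition coinvariant_relations ::
    "('g, 's) monoid_scheme \<Rightarrow> ('k, 'a) module \<Rightarrow> ('g \<Rightarrow> 'a \<Rightarrow> 'a) \<Rightarrow> 'a set"
  where "coinvariant_relations G X \<rho> = {\<rho> u x \<ominus>\<^bsub>X\<^esub> x | u x. u \<in> carrier G \<and> x \<in> carrier X}"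

definition coinvariants ::
    "('k, 'r) ring_scheme \<Rightarrow> ('g, 's) monoid_scheme \<Rightarrow> ('k, 'a) module \<Rightarrow> ('g \<Rightarrow> 'a \<Rightarrow> 'a) \<Rightarrow> ('k, 'a set) module"
  where "coinvariants K G X \<rho> = quotient_module X (span_of K X (coinvariant_relations G X \<rho>))"

definition coinvariant_class ::
    "('k, 'r) ring_scheme \<Rightarrow> ('g, 's) monoid_scheme \<Rightarrow> ('k, 'a) module \<Rightarrow> ('g \<Rightarrow> 'a \<Rightarrow> 'a) \<Rightarrow> 'a \<Rightarrow> 'a set"
  where "coinvariant_class K G X \<rho> x = span_of K X (coinvariant_relations G X \<rho>) +>\<^bsub>X\<^esub> x"


section \<open>\<open>k\<close>-categories, functors and equivalences\<close>

text \<open>\<open>Hom C x y\<close> is the space of morphisms from \<open>x\<close> to \<open>y\<close>, and \<open>Comp C x y z g f\<close> is the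
  composite of \<open>f\<close> from \<open>x\<close> to \<open>y\<close> with \<open>g\<close> from \<open>y\<close> to \<open>z\<close>. Different morphism spaces
  need not be disjoint, so every operation on morphisms takes the objects as arguments.\<close>

record ('k, 'o, 'm) kcat =
  Obj :: "'o set"
  Hom :: "'o \<Rightarrow> 'o \<Rightarrow> ('k, 'm) module"
  Comp :: "'o \<Rightarrow> 'o \<Rightarrow> 'o \<Rightarrow> 'm \<Rightarrow> 'm \<Rightarrow> 'm"
  Ident :: "'o \<Rightarrow> 'm"

locale k_category =
  fixes K :: "('k, 'r) ring_scheme" and C :: "('k, 'o, 'm) kcat"
  assumes base_field: "field K"
    and hom_module: "\<lbrakk>x \<in> Obj C; y \<in> Obj C\<rbrakk> \<Longrightarrow> module K (Hom C x y)"
    and comp_bilinear: "\<lbrakk>x \<in> Obj C; y \<in> Obj C; z \<in> Obj C\<rbrakk> \<Longrightarrow>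
      bilinear_map K (Hom C y z) (Hom C x y) (Hom C x z) (Comp C x y z)"
    and comp_assoc: "\<lbrakk>w \<in> Obj C; x \<in> Obj C; y \<in> Obj C; z \<in> Obj C;
      f \<in> carrier (Hom C w x); g \<in> carrier (Hom C x y); h \<in> carrier (Hom C y z)\<rbrakk> \<Longrightarrow>
      Comp C w y z h (Comp C w x y g f) = Comp C w x z (Comp C x y z h g) f"
    and ident_closed: "x \<in> Obj C \<Longrightarrow> Ident C x \<in> carrier (Hom C x x)"
    and ident_left: "\<lbrakk>x \<in> Obj C; y \<in> Obj C; f \<in> carrier (Hom C x y)\<rbrakk> \<Longrightarrow>
      Comp C x y y (Ident C y) f = f"
    and ident_right: "\<lbrakk>x \<in> Obj C; y \<in> Obj C; f \<in> carrier (Hom C x y)\<rbrakk> \<Longrightarrow>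
      Comp C x x y f (Ident C x) = f"

record ('o, 'm, 'p, 'n) kfunctor =
  on_obj :: "'o \<Rightarrow> 'p"
  on_hom :: "'o \<Rightarrow> 'o \<Rightarrow> 'm \<Rightarrow> 'n"

definition k_functor ::
    "('k, 'r) ring_scheme \<Rightarrow> ('k, 'o, 'm) kcat \<Rightarrow> ('k, 'p, 'n) kcat \<Rightarrow> ('o, 'm, 'p, 'n) kfunctor \<Rightarrow> bool"
  where "k_functor K C D F \<longleftrightarrow>
    on_obj F \<in> Obj C \<rightarrow> Obj D \<and>
    (\<forall>x\<in>Obj C. \<forall>y\<in>Obj C.
      linear_map K (Hom C x y) (Hom D (on_obj F x) (on_obj F y)) (on_hom F x y)) \<and>
    (\<forall>x\<in>Obj C. \<forall>y\<in>Obj C. \<forall>z\<in>Obj C. \<forall>f\<in>carrier (Hom C x y). \<forall>g\<in>carrier (Hom C y z).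
      on_hom F x z (Comp C x y z g f) =
      Comp D (on_obj F x) (on_obj F y) (on_obj F z) (on_hom F y z g) (on_hom F x y f)) \<and>
    (\<forall>x\<in>Obj C. on_hom F x x (Ident C x) = Ident D (on_obj F x))"

definition id_functor :: "('o, 'm, 'o, 'm) kfunctor"
  where "id_functor = \<lparr>on_obj = (\<lambda>x. x), on_hom = (\<lambda>x y f. f)\<rparr>"

definition comp_functor ::
    "('p, 'n, 'q, 'l) kfunctor \<Rightarrow> ('o, 'm, 'p, 'n) kfunctor \<Rightarrow> ('o, 'm, 'q, 'l) kfunctor"
  where "comp_functor H F =
    \<lparr>on_obj = (\<lambda>x. on_obj H (on_obj F x)),
     on_hom = (\<lambda>x y f. on_hom H (on_obj F x) (on_obj F y) (on_hom F x y f))\<rparr>"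

definition isomorphism :: "('k, 'o, 'm) kcat \<Rightarrow> 'o \<Rightarrow> 'o \<Rightarrow> 'm \<Rightarrow> bool"
  where "isomorphism C x y f \<longleftrightarrow>
    f \<in> carrier (Hom C x y) \<and>
    (\<exists>g\<in>carrier (Hom C y x). Comp C x y x g f = Ident C x \<and> Comp C y x y f g = Ident C y)"

definition naturally_isomorphic ::
    "('k, 'o, 'm) kcat \<Rightarrow> ('k, 'p, 'n) kcat \<Rightarrow>
     ('o, 'm, 'p, 'n) kfunctor \<Rightarrow> ('o, 'm, 'p, 'n) kfunctor \<Rightarrow> bool"
  where "naturally_isomorphic C D F F' \<longleftrightarrow>
    (\<exists>\<eta>. (\<forall>x\<in>Obj C. isomorphism D (on_obj F x) (on_obj F' x) (\<eta> x)) \<and>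
      (\<forall>x\<in>Obj C. \<forall>y\<in>Obj C. \<forall>f\<in>carrier (Hom C x y).
        Comp D (on_obj F x) (on_obj F y) (on_obj F' y) (\<eta> y) (on_hom F x y f) =
        Comp D (on_obj F x) (on_obj F' x) (on_obj F' y) (on_hom F' x y f) (\<eta> x)))"

definition k_equivalent ::
    "('k, 'r) ring_scheme \<Rightarrow> ('k, 'o, 'm) kcat \<Rightarrow> ('k, 'p, 'n) kcat \<Rightarrow> bool"
  where "k_equivalent K C D \<longleftrightarrow>
    k_category K C \<and> k_category K D \<and>
    (\<exists>F H. k_functor K C D F \<and> k_functor K D C H \<and>
      naturally_isomorphic C C (comp_functor H F) id_functor \<and>
      naturally_isomorphic D D (comp_functor F H) id_functor)"


section \<open>\<open>kG\<close>-module categories and smash extensions\<close>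

text \<open>A \<open>kG\<close>-module is given by a \<open>k\<close>-linear action of \<open>G\<close>; \<open>act s x y\<close> is the action of
  \<open>s\<close> on the morphisms from \<open>x\<close> to \<open>y\<close>.\<close>

locale kG_module_category = k_category K C + group G
  for K :: "('k, 'r) ring_scheme" and G :: "('g, 's) monoid_scheme" and C :: "('k, 'o, 'm) kcat" +
  fixes act :: "'g \<Rightarrow> 'o \<Rightarrow> 'o \<Rightarrow> 'm \<Rightarrow> 'm"
  assumes act_linear: "\<lbrakk>s \<in> carrier G; x \<in> Obj C; y \<in> Obj C\<rbrakk> \<Longrightarrow>
      linear_map K (Hom C x y) (Hom C x y) (act s x y)"
    and act_one: "\<lbrakk>x \<in> Obj C; y \<in> Obj C; f \<in> carrier (Hom C x y)\<rbrakk> \<Longrightarrow> act \<one>\<^bsub>G\<^esub> x y f = f"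
    and act_mult: "\<lbrakk>s \<in> carrier G; t \<in> carrier G; x \<in> Obj C; y \<in> Obj C; f \<in> carrier (Hom C x y)\<rbrakk> \<Longrightarrow>
      act (s \<otimes>\<^bsub>G\<^esub> t) x y f = act s x y (act t x y f)"
    and act_comp: "\<lbrakk>s \<in> carrier G; x \<in> Obj C; y \<in> Obj C; z \<in> Obj C;
      f \<in> carrier (Hom C x y); g \<in> carrier (Hom C y z)\<rbrakk> \<Longrightarrow>
      act s x z (Comp C x y z g f) = Comp C x y z (act s y z g) (act s x y f)"
    and act_ident: "\<lbrakk>s \<in> carrier G; x \<in> Obj C\<rbrakk> \<Longrightarrow> act s x x (Ident C x) = Ident C x"

definition smash_hom ::
    "('k, 'r) ring_scheme \<Rightarrow> ('g, 's) monoid_scheme \<Rightarrow> ('k, 'o, 'm) kcat \<Rightarrow> 'o \<Rightarrow> 'o \<Rightarrow>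
     ('k, ('m \<times> ('g \<Rightarrow> 'k) \<Rightarrow> 'k) set) module"
  where "smash_hom K G C x y = tensor_product K (Hom C x y) (group_space K G)"

definition smash_tensor ::
    "('k, 'r) ring_scheme \<Rightarrow> ('g, 's) monoid_scheme \<Rightarrow> ('k, 'o, 'm) kcat \<Rightarrow> 'o \<Rightarrow> 'o \<Rightarrow>
     'm \<Rightarrow> 'g \<Rightarrow> ('m \<times> ('g \<Rightarrow> 'k) \<Rightarrow> 'k) set"
  where "smash_tensor K G C x y f u = pure_tensor K (Hom C x y) (group_space K G) f (group_elem K G u)"

text \<open>The tensors \<open>f \<otimes> u\<close> with \<open>u\<close> in \<open>G\<close> span the morphism spaces, so on these spaces the
  composition is the only bilinear map with the prescribed values.\<close>

definition smash_category ::
    "('k, 'r) ring_scheme \<Rightarrow> ('g, 's) monoid_scheme \<Rightarrow> ('k, 'o, 'm) kcat \<Rightarrow>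
     ('g \<Rightarrow> 'o \<Rightarrow> 'o \<Rightarrow> 'm \<Rightarrow> 'm) \<Rightarrow> ('k, 'o, ('m \<times> ('g \<Rightarrow> 'k) \<Rightarrow> 'k) set) kcat"
  where "smash_category K G C act =
    \<lparr>Obj = Obj C,
     Hom = smash_hom K G C,
     Comp = (\<lambda>x y z. SOME \<mu>.
       bilinear_map K (smash_hom K G C y z) (smash_hom K G C x y) (smash_hom K G C x z) \<mu> \<and>
       (\<forall>g\<in>carrier (Hom C y z). \<forall>f\<in>carrier (Hom C x y). \<forall>v\<in>carrier G. \<forall>u\<in>carrier G.
         \<mu> (smash_tensor K G C y z g v) (smash_tensor K G C x y f u) =
         smash_tensor K G C x z (Comp C x y z g (act v x y f)) (v \<otimes>\<^bsub>G\<^esub> u))),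
     Ident = (\<lambda>x. smash_tensor K G C x x (Ident C x) \<one>\<^bsub>G\<^esub>)\<rparr>"

definition smash_functor ::
    "('k, 'r) ring_scheme \<Rightarrow> ('g, 's) monoid_scheme \<Rightarrow> ('k, 'o, 'm) kcat \<Rightarrow>
     ('o, 'm, 'o, ('m \<times> ('g \<Rightarrow> 'k) \<Rightarrow> 'k) set) kfunctor"
  where "smash_functor K G C =
    \<lparr>on_obj = (\<lambda>x. x), on_hom = (\<lambda>x y f. smash_tensor K G C x y f \<one>\<^bsub>G\<^esub>)\<rparr>"

definition smash_extension ::
    "('k, 'r) ring_scheme \<Rightarrow> ('g, 's) monoid_scheme \<Rightarrow> ('k, 'o, 'm) kcat \<Rightarrow>
     ('g \<Rightarrow> 'o \<Rightarrow> 'o \<Rightarrow> 'm \<Rightarrow> 'm) \<Rightarrow> ('k, 'o, ('m \<times> ('g \<Rightarrow> 'k) \<Rightarrow> 'k) set) kcat \<Rightarrow>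
     ('o, 'm, 'o, ('m \<times> ('g \<Rightarrow> 'k) \<Rightarrow> 'k) set) kfunctor \<Rightarrow> bool"
  where "smash_extension K G C act B S \<longleftrightarrow>
    kG_module_category K G C act \<and> B = smash_category K G C act \<and> S = smash_functor K G C"


section \<open>Free group actions on \<open>k\<close>-categories and their quotients\<close>

record ('g, 'o, 'm) cat_action =
  act_obj :: "'g \<Rightarrow> 'o \<Rightarrow> 'o"
  act_hom :: "'g \<Rightarrow> 'o \<Rightarrow> 'o \<Rightarrow> 'm \<Rightarrow> 'm"

locale free_category_action = k_category K D + group_action G "Obj D" "act_obj A"
  for K :: "('k, 'r) ring_scheme" and G :: "('g, 's) monoid_scheme"
    and D :: "('k, 'o, 'm) kcat" and A :: "('g, 'o, 'm) cat_action" +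
  assumes act_linear: "\<lbrakk>s \<in> carrier G; a \<in> Obj D; b \<in> Obj D\<rbrakk> \<Longrightarrow>
      linear_map K (Hom D a b) (Hom D (act_obj A s a) (act_obj A s b)) (act_hom A s a b)"
    and act_one: "\<lbrakk>a \<in> Obj D; b \<in> Obj D; f \<in> carrier (Hom D a b)\<rbrakk> \<Longrightarrow> act_hom A \<one>\<^bsub>G\<^esub> a b f = f"
    and act_mult: "\<lbrakk>s \<in> carrier G; t \<in> carrier G; a \<in> Obj D; b \<in> Obj D; f \<in> carrier (Hom D a b)\<rbrakk> \<Longrightarrow>
      act_hom A (s \<otimes>\<^bsub>G\<^esub> t) a b f = act_hom A s (act_obj A t a) (act_obj A t b) (act_hom A t a b f)"
    and act_comp: "\<lbrakk>s \<in> carrier G; a \<in> Obj D; b \<in> Obj D; c \<in> Obj D;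
      f \<in> carrier (Hom D a b); g \<in> carrier (Hom D b c)\<rbrakk> \<Longrightarrow>
      act_hom A s a c (Comp D a b c g f) =
      Comp D (act_obj A s a) (act_obj A s b) (act_obj A s c) (act_hom A s b c g) (act_hom A s a b f)"
    and act_ident: "\<lbrakk>s \<in> carrier G; a \<in> Obj D\<rbrakk> \<Longrightarrow>
      act_hom A s a a (Ident D a) = Ident D (act_obj A s a)"
    and free: "\<lbrakk>s \<in> carrier G; a \<in> Obj D; act_obj A s a = a\<rbrakk> \<Longrightarrow> s = \<one>\<^bsub>G\<^esub>"

text \<open>For orbits \<open>\<alpha>\<close> and \<open>\<beta>\<close>, the sum of the morphism spaces from \<open>a\<close> to \<open>b\<close> is indexed by
  the pairs \<open>(b, a)\<close> in \<open>\<beta> \<times> \<alpha>\<close>. An element \<open>u\<close> of \<open>G\<close> carries the component at \<open>(b, a)\<close> to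
  the component at \<open>(ub, ua)\<close>.\<close>

definition orbit_sum :: "('k, 'o, 'm) kcat \<Rightarrow> 'o set \<Rightarrow> 'o set \<Rightarrow> ('k, 'o \<times> 'o \<Rightarrow> 'm) module"
  where "orbit_sum D \<alpha> \<beta> = direct_sum (\<beta> \<times> \<alpha>) (\<lambda>(b, a). Hom D a b)"

definition orbit_sum_act ::
    "('g, 's) monoid_scheme \<Rightarrow> ('g, 'o, 'm) cat_action \<Rightarrow> 'o set \<Rightarrow> 'o set \<Rightarrow>
     'g \<Rightarrow> ('o \<times> 'o \<Rightarrow> 'm) \<Rightarrow> ('o \<times> 'o \<Rightarrow> 'm)"
  where "orbit_sum_act G A \<alpha> \<beta> u \<Phi> =
    (\<lambda>(b, a)\<in>\<beta> \<times> \<alpha>.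
      (let a' = act_obj A (inv\<^bsub>G\<^esub> u) a; b' = act_obj A (inv\<^bsub>G\<^esub> u) b
       in act_hom A u a' b' (\<Phi> (b', a'))))"

definition quotient_hom ::
    "('k, 'r) ring_scheme \<Rightarrow> ('g, 's) monoid_scheme \<Rightarrow> ('k, 'o, 'm) kcat \<Rightarrow> ('g, 'o, 'm) cat_action \<Rightarrow>
     'o set \<Rightarrow> 'o set \<Rightarrow> ('k, ('o \<times> 'o \<Rightarrow> 'm) set) module"
  where "quotient_hom K G D A \<alpha> \<beta> = coinvariants K G (orbit_sum D \<alpha> \<beta>) (orbit_sum_act G A \<alpha> \<beta>)"

text \<open>The class \<open>[f]\<close>, from \<open>\<alpha>\<close> to \<open>\<beta>\<close>, of a morphism \<open>f\<close> from \<open>a\<close> in \<open>\<alpha>\<close> to \<open>b\<close> in \<open>\<beta>\<close>.\<close>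

definition quotient_class ::
    "('k, 'r) ring_scheme \<Rightarrow> ('g, 's) monoid_scheme \<Rightarrow> ('k, 'o, 'm) kcat \<Rightarrow> ('g, 'o, 'm) cat_action \<Rightarrow>
     'o set \<Rightarrow> 'o set \<Rightarrow> 'o \<Rightarrow> 'o \<Rightarrow> 'm \<Rightarrow> ('o \<times> 'o \<Rightarrow> 'm) set"
  where "quotient_class K G D A \<alpha> \<beta> a b f =
    coinvariant_class K G (orbit_sum D \<alpha> \<beta>) (orbit_sum_act G A \<alpha> \<beta>)
      (summand (\<beta> \<times> \<alpha>) (\<lambda>(b, a). Hom D a b) (b, a) f)"

text \<open>As the classes \<open>[f]\<close> span the morphism spaces, the composition is determined on these
  spaces by its bilinearity and its values on classes. The identity of \<open>\<alpha>\<close> is the class of the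
  identity of any \<open>a\<close> in \<open>\<alpha>\<close>.\<close>

definition quotient_category ::
    "('k, 'r) ring_scheme \<Rightarrow> ('g, 's) monoid_scheme \<Rightarrow> ('k, 'o, 'm) kcat \<Rightarrow> ('g, 'o, 'm) cat_action \<Rightarrow>
     ('k, 'o set, ('o \<times> 'o \<Rightarrow> 'm) set) kcat"
  where "quotient_category K G D A =
    \<lparr>Obj = orbits G (Obj D) (act_obj A),
     Hom = quotient_hom K G D A,
     Comp = (\<lambda>\<alpha> \<beta> \<gamma>. SOME \<mu>.
       bilinear_map K (quotient_hom K G D A \<beta> \<gamma>) (quotient_hom K G D A \<alpha> \<beta>) (quotient_hom K G D A \<alpha> \<gamma>) \<mu> \<and>
       (\<forall>a\<in>\<alpha>. \<forall>b\<in>\<beta>. \<forall>c\<in>\<beta>. \<forall>d\<in>\<gamma>. \<forall>f\<in>carrier (Hom D a b). \<forall>g\<in>carrier (Hom D c d).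
         \<forall>s\<in>carrier G. c = act_obj A s b \<longrightarrow>
         \<mu> (quotient_class K G D A \<beta> \<gamma> c d g) (quotient_class K G D A \<alpha> \<beta> a b f) =
         quotient_class K G D A \<alpha> \<gamma> (act_obj A s a) d
           (Comp D (act_obj A s a) c d g (act_hom A s a b f)))),
     Ident = (\<lambda>\<alpha>. let a = (SOME a. a \<in> \<alpha>) in quotient_class K G D A \<alpha> \<alpha> a a (Ident D a))\<rparr>"

definition galois_projection ::
    "('k, 'r) ring_scheme \<Rightarrow> ('g, 's) monoid_scheme \<Rightarrow> ('k, 'o, 'm) kcat \<Rightarrow> ('g, 'o, 'm) cat_action \<Rightarrow>
     ('o, 'm, 'o set, ('o \<times> 'o \<Rightarrow> 'm) set) kfunctor"
  where "galois_projection K G D A =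
    \<lparr>on_obj = orbit G (act_obj A),
     on_hom = (\<lambda>a b f. quotient_class K G D A (orbit G (act_obj A) a) (orbit G (act_obj A) b) a b f)\<rparr>"


section \<open>The inflated category\<close>

definition inflated_category ::
    "('g, 's) monoid_scheme \<Rightarrow> ('k, 'o, 'm) kcat \<Rightarrow> ('k, 'o \<times> 'g, 'm) kcat"
  where "inflated_category G C =
    \<lparr>Obj = Obj C \<times> carrier G,
     Hom = (\<lambda>(x, s) (y, t). Hom C x y),
     Comp = (\<lambda>(x, s) (y, t) (z, r). Comp C x y z),
     Ident = (\<lambda>(x, s). Ident C x)\<rparr>"

definition inflated_action ::
    "('g, 's) monoid_scheme \<Rightarrow> ('k, 'o, 'm) kcat \<Rightarrow> ('g \<Rightarrow> 'o \<Rightarrow> 'o \<Rightarrow> 'm \<Rightarrow> 'm) \<Rightarrow>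
     ('g, 'o \<times> 'g, 'm) cat_action"
  where "inflated_action G C act =
    \<lparr>act_obj = (\<lambda>u. \<lambda>(x, s)\<in>Obj C \<times> carrier G. (x, u \<otimes>\<^bsub>G\<^esub> s)),
     act_hom = (\<lambda>u (x, s) (y, t). act u x y)\<rparr>"

lemma (in kG_module_category) inflated_k_category: "k_category K (inflated_category G C)"
  by (rule k_category.intro)
    (auto simp: inflated_category_def base_field hom_module comp_bilinear comp_assoc
      ident_closed ident_left ident_right)

lemma (in kG_module_category) inflated_free_action:
  "free_category_action K G (inflated_category G C) (inflated_action G C act)"
proof -
  let ?E = "Obj C \<times> carrier G"
  let ?\<phi> = "act_obj (inflated_action G C act)"
  have bij: "?\<phi> u \<in> Bij ?E" if u: "u \<in> carrier G" for u
  proof -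
    have "bij_betw (\<lambda>(x, s). (x, u \<otimes>\<^bsub>G\<^esub> s)) ?E ?E"
      by (rule bij_betw_byWitness[where f' = "\<lambda>(x, s). (x, inv\<^bsub>G\<^esub> u \<otimes>\<^bsub>G\<^esub> s)"])
        (use u in \<open>auto simp: m_assoc[symmetric]\<close>)
    then show ?thesis
      unfolding Bij_def inflated_action_def by (auto simp: bij_betw_restrict_eq)
  qed
  have "?\<phi> (u \<otimes>\<^bsub>G\<^esub> v) = compose ?E (?\<phi> u) (?\<phi> v)" if "u \<in> carrier G" "v \<in> carrier G" for u v
    using that by (auto simp: inflated_action_def compose_def fun_eq_iff m_assoc)
  with bij have "?\<phi> \<in> hom G (BijGroup ?E)"
    by (auto simp: hom_def BijGroup_def)
  then have "group_action G (Obj (inflated_category G C)) ?\<phi>"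
    by (simp add: group_action_def group_hom_def group_hom_axioms_def group_BijGroup
        is_group inflated_category_def)
  then show ?thesis
    unfolding free_category_action_def free_category_action_axioms_def
    using inflated_k_category
    by (auto simp: inflated_category_def inflated_action_def act_linear act_one act_mult act_comp
        act_ident)
qed

end

theory Submission
  imports Defs
begin

text \<open>
  Both \<open>\<C> # kG\<close> and \<open>(I\<^sub>G \<C>)/G\<close> are isomorphic to the category of graded morphisms: its
  objects are those of \<open>\<C>\<close>, the morphisms from \<open>x\<close> to \<open>y\<close> are the finitely supported
  families of morphisms of \<open>\<C>\<close> indexed by \<open>G\<close>, and homogeneous morphisms compose by
  \<open>(g in degree v) (f in degree u) = (g (v f) in degree vu)\<close>. The morphism \<open>f\<close> in degree \<open>u\<close>
  corresponds to \<open>f \<otimes> u\<close> in the smash category and to the class of \<open>f\<close>, viewed as a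
  morphism from \<open>(x, u)\<close> to \<open>(y, 1)\<close>, in the quotient. Conversely, the class of a morphism
  \<open>f\<close> from \<open>(x, s)\<close> to \<open>(y, t)\<close> is translated by the inverse of \<open>t\<close> to that of \<open>t\<inverse> f\<close> from
  \<open>(x, t\<inverse> s)\<close> to \<open>(y, 1)\<close>, so it corresponds to \<open>t\<inverse> f\<close> in degree \<open>t\<inverse> s\<close>.
  All identities are checked on generators and extended by linearity.
\<close>

section \<open>Linear maps and generating sets\<close>

text \<open>All three compositions are chosen by \<open>SOME\<close>, so each needs a bilinear map
  with prescribed values on generators. In a tensor product or a space of coinvariants the
  generators satisfy relations, and existence would have to be argued against them. A direct sum
  imposes no such condition: bilinear maps given on the components glue freely. The composition is
  therefore built, and associativity verified, only for graded morphisms; linear bijections then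
  carry both to the smash category and to the quotient.

  The degrees come from normalizing targets to 1. For \<open>f\<close> from \<open>(x, u)\<close> to
  \<open>(y, 1)\<close> and \<open>g\<close> from \<open>(y, v)\<close> to \<open>(z, 1)\<close>,
  the element \<open>v\<close> moves the target of \<open>f\<close> to the source of
  \<open>g\<close>. The composite of \<open>g\<close> with \<open>v f\<close> starts at
  \<open>(x, v u)\<close>, which explains both the twist of \<open>f\<close> by \<open>v\<close> and
  the degree \<open>v u\<close>.

  The equivalence of the inflated category with \<open>C\<close> is of another kind: it merges the
  objects \<open>(x, s)\<close>, which are isomorphic to one another through the identity of
  \<open>x\<close>, whereas the other equivalence comes from an isomorphism of categories.\<close>

lemma linear_mapI:
  assumes "\<And>x. x \<in> carrier V \<Longrightarrow> f x \<in> carrier W"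
    and "\<And>x y. \<lbrakk>x \<in> carrier V; y \<in> carrier V\<rbrakk> \<Longrightarrow> f (x \<oplus>\<^bsub>V\<^esub> y) = f x \<oplus>\<^bsub>W\<^esub> f y"
    and "\<And>c x. \<lbrakk>c \<in> carrier K; x \<in> carrier V\<rbrakk> \<Longrightarrow> f (c \<odot>\<^bsub>V\<^esub> x) = c \<odot>\<^bsub>W\<^esub> f x"
  shows "linear_map K V W f"
  using assms by (auto simp: linear_map_def)

lemma linear_map_closed: "linear_map K V W f \<Longrightarrow> x \<in> carrier V \<Longrightarrow> f x \<in> carrier W"
  by (auto simp: linear_map_def)

lemma linear_map_add:
  "\<lbrakk>linear_map K V W f; x \<in> carrier V; y \<in> carrier V\<rbrakk> \<Longrightarrow> f (x \<oplus>\<^bsub>V\<^esub> y) = f x \<oplus>\<^bsub>W\<^esub> f y"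
  by (auto simp: linear_map_def)

lemma linear_map_smult:
  "\<lbrakk>linear_map K V W f; c \<in> carrier K; x \<in> carrier V\<rbrakk> \<Longrightarrow> f (c \<odot>\<^bsub>V\<^esub> x) = c \<odot>\<^bsub>W\<^esub> f x"
  by (auto simp: linear_map_def)

lemma linear_map_abelian_group_hom:
  assumes "module K V" "module K W" "linear_map K V W f"
  shows "abelian_group_hom V W f"
proof -
  interpret V: module K V by fact
  interpret W: module K W by fact
  show ?thesis
    using assms(3) V.a_group W.a_group
    by (intro abelian_group_homI V.abelian_group_axioms W.abelian_group_axioms)
      (auto simp: group_hom_def group_hom_axioms_def hom_def linear_map_def)
qed

lemma linear_map_zero:
  "\<lbrakk>module K V; module K W; linear_map K V W f\<rbrakk> \<Longrightarrow> f \<zero>\<^bsub>V\<^esub> = \<zero>\<^bsub>W\<^esub>"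
  by (rule abelian_group_hom.hom_zero[OF linear_map_abelian_group_hom])

lemma linear_map_a_inv:
  "\<lbrakk>module K V; module K W; linear_map K V W f; x \<in> carrier V\<rbrakk> \<Longrightarrow> f (\<ominus>\<^bsub>V\<^esub> x) = \<ominus>\<^bsub>W\<^esub> f x"
  by (rule abelian_group_hom.hom_a_inv[OF linear_map_abelian_group_hom])

lemma linear_map_minus:
  assumes "module K V" "module K W" "linear_map K V W f" "x \<in> carrier V" "y \<in> carrier V"
  shows "f (x \<ominus>\<^bsub>V\<^esub> y) = f x \<ominus>\<^bsub>W\<^esub> f y"
proof -
  interpret V: module K V by fact
  show ?thesis
    using assms by (simp add: a_minus_def linear_map_add linear_map_a_inv)
qed

lemma module_cring: "module K V \<Longrightarrow> cring K"
  by (simp add: module_def)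

lemma linear_map_id: "linear_map K V V (\<lambda>x. x)"
  by (auto simp: linear_map_def)

lemma linear_map_compose:
  "\<lbrakk>linear_map K U V f; linear_map K V W g\<rbrakk> \<Longrightarrow> linear_map K U W (\<lambda>x. g (f x))"
  by (auto simp: linear_map_def Pi_iff)

lemma linear_map_inverse:
  assumes f: "linear_map K V W f" and V: "module K V" and W: "module K W"
    and g: "\<And>y. y \<in> carrier W \<Longrightarrow> g y \<in> carrier V"
    and fg: "\<And>y. y \<in> carrier W \<Longrightarrow> f (g y) = y"
    and gf: "\<And>x. x \<in> carrier V \<Longrightarrow> g (f x) = x"
  shows "linear_map K W V g"
proof -
  interpret V: module K V by fact
  interpret W: module K W by fact
  show ?thesis
  proof (rule linear_mapI)
    fix x y assume xy: "x \<in> carrier W" "y \<in> carrier W"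
    then have "x \<oplus>\<^bsub>W\<^esub> y = f (g x \<oplus>\<^bsub>V\<^esub> g y)"
      by (simp add: linear_map_add[OF f] g fg)
    with xy show "g (x \<oplus>\<^bsub>W\<^esub> y) = g x \<oplus>\<^bsub>V\<^esub> g y"
      by (simp add: gf g)
  next
    fix c x assume cx: "c \<in> carrier K" "x \<in> carrier W"
    then have "c \<odot>\<^bsub>W\<^esub> x = f (c \<odot>\<^bsub>V\<^esub> g x)"
      by (simp add: linear_map_smult[OF f] g fg)
    with cx show "g (c \<odot>\<^bsub>W\<^esub> x) = c \<odot>\<^bsub>V\<^esub> g x"
      by (simp add: gf g)
  qed (fact g)
qed

lemma bilinear_mapD:
  assumes "bilinear_map K U V W h"
  shows "x \<in> carrier U \<Longrightarrow> linear_map K V W (h x)"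
    and "y \<in> carrier V \<Longrightarrow> linear_map K U W (\<lambda>x. h x y)"
    and "\<lbrakk>x \<in> carrier U; y \<in> carrier V\<rbrakk> \<Longrightarrow> h x y \<in> carrier W"
  using assms by (auto simp: bilinear_map_def linear_map_def Pi_iff)

lemma bilinear_map_compose:
  assumes "bilinear_map K U V W h" "linear_map K U' U f" "linear_map K V' V g" "linear_map K W W' k"
  shows "bilinear_map K U' V' W' (\<lambda>x y. k (h (f x) (g y)))"
proof -
  have "linear_map K V' W' (\<lambda>y. k (h (f x) (g y)))" if "x \<in> carrier U'" for x
    by (rule linear_map_compose[OF linear_map_compose[OF assms(3)] assms(4)])
      (rule bilinear_mapD(1)[OF assms(1) linear_map_closed[OF assms(2) that]])
  moreover have "linear_map K U' W' (\<lambda>x. k (h (f x) (g y)))" if "y \<in> carrier V'" for y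
    by (rule linear_map_compose[OF linear_map_compose[OF assms(2), where g = "\<lambda>x. h x (g y)"] assms(4)])
      (rule bilinear_mapD(2)[OF assms(1) linear_map_closed[OF assms(3) that]])
  ultimately show ?thesis
    by (simp add: bilinear_map_def)
qed

text \<open>Phrased through submodules instead of linear combinations: a property extends from
  generators to the whole module as soon as the elements that have it form a submodule.\<close>

definition generates :: "('k, 'r) ring_scheme \<Rightarrow> ('k, 'a) module \<Rightarrow> 'a set \<Rightarrow> bool"
  where "generates K M S \<longleftrightarrow> S \<subseteq> carrier M \<and> (\<forall>N. submodule N K M \<longrightarrow> S \<subseteq> N \<longrightarrow> carrier M \<subseteq> N)"

lemma generates_subset: "\<lbrakk>generates K M S; submodule N K M; S \<subseteq> N; x \<in> carrier M\<rbrakk> \<Longrightarrow> x \<in> N"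
  by (auto simp: generates_def)

text \<open>The basis of every extension by linearity below: if the generators lie in this
  equalizer, so does the whole module.\<close>

lemma submodule_equalizer:
  assumes "module K V" "module K W" "linear_map K V W f" "linear_map K V W g"
  shows "submodule {x \<in> carrier V. f x = g x} K V"
proof -
  interpret V: module K V by fact
  show ?thesis
    using assms
    by (intro V.submoduleI)
      (auto simp: linear_map_add linear_map_smult linear_map_zero[of K V W] linear_map_a_inv[of K V W])
qed

lemma linear_map_eq:
  assumes "generates K V S" "module K V" "module K W" "linear_map K V W f" "linear_map K V W g"
    and "\<And>s. s \<in> S \<Longrightarrow> f s = g s" and "x \<in> carrier V"
  shows "f x = g x"
  using submodule_equalizer[OF assms(2-5)] assms(1,6,7) by (auto simp: generates_def)

text \<open>Two uses of \<open>linear_map_eq\<close>: with \<open>y\<close> fixed, the left argument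
  is reduced to a generator \<open>s\<close>; with \<open>s\<close> fixed, the right argument is
  reduced to a generator as well.\<close>

lemma bilinear_map_eq:
  assumes "generates K U S" "generates K V T" "module K U" "module K V" "module K W"
    and "bilinear_map K U V W h" "bilinear_map K U V W h'"
    and eq: "\<And>s t. \<lbrakk>s \<in> S; t \<in> T\<rbrakk> \<Longrightarrow> h s t = h' s t"
    and "x \<in> carrier U" "y \<in> carrier V"
  shows "h x y = h' x y"
proof (rule linear_map_eq[where f = "\<lambda>x. h x y" and g = "\<lambda>x. h' x y", OF assms(1,3,5)])
  fix s assume s: "s \<in> S"
  then have sU: "s \<in> carrier U"
    using assms(1) by (auto simp: generates_def)
  show "h s y = h' s y"
    by (rule linear_map_eq[where f = "h s" and g = "h' s", OF assms(2,4,5)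
          bilinear_mapD(1)[OF assms(6) sU] bilinear_mapD(1)[OF assms(7) sU] eq[OF s] assms(10)])
qed (rule bilinear_mapD(2)[OF assms(6,10)] bilinear_mapD(2)[OF assms(7,10)] assms(9))+

lemma submodule_vimage:
  assumes "module K V" "module K W" "linear_map K V W f" "submodule N K W"
  shows "submodule {x \<in> carrier V. f x \<in> N} K V"
proof -
  interpret V: module K V by fact
  interpret W: module K W by fact
  interpret N: submodule N K W by fact
  have "\<zero>\<^bsub>W\<^esub> \<in> N"
    using N.one_closed by simp
  then show ?thesis
    using assms W.submoduleE[OF assms(4)]
    by (intro V.submoduleI)
      (auto simp: linear_map_add linear_map_smult linear_map_zero[of K V W] linear_map_a_inv[of K V W])
qed

lemma generates_image:
  assumes "module K V" "module K W" "linear_map K V W f" "f ` carrier V = carrier W" "generates K V S"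
  shows "generates K W (f ` S)"
  unfolding generates_def
proof (intro conjI allI impI)
  show "f ` S \<subseteq> carrier W"
    using assms(4,5) by (auto simp: generates_def)
  fix N assume N: "submodule N K W" "f ` S \<subseteq> N"
  have "S \<subseteq> {x \<in> carrier V. f x \<in> N}"
    using N(2) assms(5) by (auto simp: generates_def)
  then have "carrier V \<subseteq> {x \<in> carrier V. f x \<in> N}"
    using submodule_vimage[OF assms(1-3) N(1)] assms(5) unfolding generates_def by blast
  then show "carrier W \<subseteq> N"
    unfolding assms(4)[symmetric] by auto
qed

section \<open>Spans, and linear maps determined by generators\<close>

lemma submodule_span_of:
  assumes "module K M" "S \<subseteq> carrier M"
  shows "submodule (span_of K M S) K M"
proof -
  interpret M: module K M by fact
  have sub: "submodule N K M \<Longrightarrow> \<zero>\<^bsub>M\<^esub> \<in> N" for N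
    using submodule.axioms(1)[of N K M] subgroup.one_closed[of N "add_monoid M"] by simp
  show ?thesis
    using assms(2) M.carrier_is_submodule M.submoduleE(3-5) sub
    by (intro M.submoduleI) (auto simp: span_of_def)
qed

lemma span_of_subset: "\<lbrakk>submodule N K M; S \<subseteq> N\<rbrakk> \<Longrightarrow> span_of K M S \<subseteq> N"
  by (auto simp: span_of_def)

lemma span_of_superset: "S \<subseteq> span_of K M S"
  by (auto simp: span_of_def)

lemma linear_map_zero_on_span:
  assumes "module K V" "module K W" "linear_map K V W f"
    and "\<And>s. s \<in> S \<Longrightarrow> s \<in> carrier V \<and> f s = \<zero>\<^bsub>W\<^esub>" and "x \<in> span_of K V S"
  shows "f x = \<zero>\<^bsub>W\<^esub>"
proof -
  interpret W: module K W by fact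
  have "linear_map K V W (\<lambda>_. \<zero>\<^bsub>W\<^esub>)"
    by (rule linear_mapI) auto
  from submodule_equalizer[OF assms(1-3) this] assms(4) have "span_of K V S \<subseteq> {x \<in> carrier V. f x = \<zero>\<^bsub>W\<^esub>}"
    by (intro span_of_subset) auto
  with assms(5) show ?thesis by auto
qed


text \<open>Injectivity into a tensor product or a space of coinvariants is hard to see directly. A
  linear candidate for the inverse replaces it by two identities on generators.\<close>

lemma bij_betw_generators:
  assumes "module K V" "module K W" and f: "linear_map K V W f" and g: "linear_map K W V g"
    and S: "generates K V S" "\<And>s. s \<in> S \<Longrightarrow> g (f s) = s"
    and T: "generates K W T" "\<And>t. t \<in> T \<Longrightarrow> f (g t) = t"
  shows "bij_betw f (carrier V) (carrier W)"
proof (rule bij_betw_byWitness[where f' = g])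
  show "\<forall>x\<in>carrier V. g (f x) = x"
    using linear_map_eq[OF S(1) assms(1,1) linear_map_compose[OF f g] linear_map_id S(2)] by blast
  show "\<forall>y\<in>carrier W. f (g y) = y"
    using linear_map_eq[OF T(1) assms(2,2) linear_map_compose[OF g f] linear_map_id T(2)] by blast
qed (use f g in \<open>auto intro: linear_map_closed\<close>)

lemma linear_map_inv_into:
  assumes "module K V" "module K W" "linear_map K V W f" "bij_betw f (carrier V) (carrier W)"
  shows "linear_map K W V (inv_into (carrier V) f)"
  using assms(4)
  by (intro linear_map_inverse[OF assms(3,1,2)])
    (auto simp: bij_betw_def inv_into_into f_inv_into_f)

text \<open>Provides the witness for the \<open>SOME\<close> in the smash and quotient compositions:
  there \<open>h\<close> is the composition of graded morphisms, and \<open>f\<close>,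
  \<open>g\<close>, \<open>k\<close> are the comparison maps of the morphism spaces.\<close>

lemma bilinear_map_transport:
  assumes U: "module K U" "module K U'" "linear_map K U U' f" "bij_betw f (carrier U) (carrier U')"
    and V: "module K V" "module K V'" "linear_map K V V' g" "bij_betw g (carrier V) (carrier V')"
    and k: "linear_map K W W' k" and h: "bilinear_map K U V W h"
  obtains h' where "bilinear_map K U' V' W' h'"
    and "\<And>x y. \<lbrakk>x \<in> carrier U; y \<in> carrier V\<rbrakk> \<Longrightarrow> h' (f x) (g y) = k (h x y)"
proof
  show "bilinear_map K U' V' W' (\<lambda>x y. k (h (inv_into (carrier U) f x) (inv_into (carrier V) g y)))"
    by (rule bilinear_map_compose[OF h linear_map_inv_into[OF U] linear_map_inv_into[OF V] k])
  show "k (h (inv_into (carrier U) f (f x)) (inv_into (carrier V) g (g y))) = k (h x y)"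
    if "x \<in> carrier U" "y \<in> carrier V" for x y
    using that U(4) V(4) by (simp add: bij_betw_def)
qed


section \<open>Quotient modules\<close>

lemma quotient_module_facts:
  assumes M: "module K M" and N: "submodule N K M"
  shows quotient_module_carrier: "carrier (quotient_module M N) = (\<lambda>x. N +>\<^bsub>M\<^esub> x) ` carrier M"
    and linear_map_quotient: "linear_map K M (quotient_module M N) (\<lambda>x. N +>\<^bsub>M\<^esub> x)"
    and coset_eqI: "\<lbrakk>x \<in> carrier M; y \<in> carrier M; x \<ominus>\<^bsub>M\<^esub> y \<in> N\<rbrakk> \<Longrightarrow> N +>\<^bsub>M\<^esub> x = N +>\<^bsub>M\<^esub> y"
    and module_quotient: "module K (quotient_module M N)"
proof -
  interpret M: module K M by fact
  interpret N: submodule N K M by fact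
  interpret abelian_subgroup N M
    by (intro abelian_subgroupI3 additive_subgroupI N.subgroup_axioms M.abelian_group_axioms)
  let ?Q = "quotient_module M N" and ?p = "\<lambda>x. N +>\<^bsub>M\<^esub> x"
  have carr: "carrier ?Q = ?p ` carrier M"
    by (auto simp: quotient_module_def A_RCOSETS_def RCOSETS_def a_r_coset_def)
  have eqI: "?p x = ?p y" if "x \<in> carrier M" "y \<in> carrier M" "x \<ominus>\<^bsub>M\<^esub> y \<in> N" for x y
  proof -
    have "x = (x \<ominus>\<^bsub>M\<^esub> y) \<oplus>\<^bsub>M\<^esub> y"
      using that by (simp add: a_minus_def M.a_assoc M.l_neg)
    then have "x \<in> ?p y"
      using M.a_rcosI[OF that(3) a_subset that(2)] by simp
    then show ?thesis
      using M.a_repr_independence[OF _ that(2) a_subgroup] by simp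
  qed
  have smult: "c \<odot>\<^bsub>?Q\<^esub> ?p x = ?p (c \<odot>\<^bsub>M\<^esub> x)" if cx: "c \<in> carrier K" "x \<in> carrier M" for c x
  proof -
    \<comment> \<open>Scalar multiplication of a coset is defined as a union over all its
      representatives. All members of this union coincide, and the union is not empty because a
      coset contains its representative.\<close>
    have const: "?p (c \<odot>\<^bsub>M\<^esub> a) = ?p (c \<odot>\<^bsub>M\<^esub> x)" if a: "a \<in> ?p x" for a
    proof -
      obtain n where n: "n \<in> N" "a = n \<oplus>\<^bsub>M\<^esub> x"
        using a by (auto simp: a_r_coset_def r_coset_def)
      then have nM: "n \<in> carrier M" using a_subset by auto
      have "c \<odot>\<^bsub>M\<^esub> a \<ominus>\<^bsub>M\<^esub> c \<odot>\<^bsub>M\<^esub> x = c \<odot>\<^bsub>M\<^esub> n"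
        using n cx nM by (simp add: a_minus_def M.smult_r_distr M.a_assoc M.r_neg)
      then show ?thesis
        using n nM cx by (intro eqI) auto
    qed
    have "c \<odot>\<^bsub>?Q\<^esub> ?p x = (\<Union>a\<in>?p x. ?p (c \<odot>\<^bsub>M\<^esub> a))"
      by (simp add: quotient_module_def)
    also have "\<dots> = (\<Union>a\<in>?p x. ?p (c \<odot>\<^bsub>M\<^esub> x))"
      by (rule SUP_cong[OF refl const])
    also have "\<dots> = ?p (c \<odot>\<^bsub>M\<^esub> x)"
      using a_rcos_self[OF cx(2)] by blast
    finally show ?thesis .
  qed
  have add: "?p x \<oplus>\<^bsub>?Q\<^esub> ?p y = ?p (x \<oplus>\<^bsub>M\<^esub> y)" if "x \<in> carrier M" "y \<in> carrier M" for x y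
    using that by (simp add: quotient_module_def a_rcos_sum)
  have zero: "\<zero>\<^bsub>?Q\<^esub> = ?p \<zero>\<^bsub>M\<^esub>"
    using a_subset by (simp add: quotient_module_def)
  show "carrier ?Q = ?p ` carrier M" by (fact carr)
  show "linear_map K M ?Q ?p"
    by (rule linear_mapI) (auto simp: carr smult add)
  show "?p x = ?p y" if "x \<in> carrier M" "y \<in> carrier M" "x \<ominus>\<^bsub>M\<^esub> y \<in> N"
    using that by (rule eqI)
  have "abelian_group ?Q"
  proof (rule abelian_groupI)
    fix x assume "x \<in> carrier ?Q"
    then obtain a where a: "a \<in> carrier M" "x = ?p a" by (auto simp: carr)
    then show "\<exists>y\<in>carrier ?Q. y \<oplus>\<^bsub>?Q\<^esub> x = \<zero>\<^bsub>?Q\<^esub>"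
      by (intro bexI[of _ "?p (\<ominus>\<^bsub>M\<^esub> a)"]) (auto simp: carr add zero M.l_neg)
  qed (auto simp: carr add zero M.a_ac)
  then show "module K ?Q"
    by (rule moduleI[OF M.R.cring_axioms])
      (auto simp: carr add smult M.smult_l_distr M.smult_r_distr M.smult_assoc1)
qed

text \<open>The induced map on cosets, evaluated at an arbitrary representative. It has the expected
  value once \<open>f\<close> vanishes on the submodule, since representatives differ by an element
  of it.\<close>

definition quotient_lift :: "('a \<Rightarrow> 'b) \<Rightarrow> 'a set \<Rightarrow> 'b"
  where "quotient_lift f A = f (SOME a. a \<in> A)"

lemma quotient_lift:
  assumes M: "module K M" and W: "module K W" and f: "linear_map K M W f"
    and S: "\<And>s. s \<in> S \<Longrightarrow> s \<in> carrier M \<and> f s = \<zero>\<^bsub>W\<^esub>"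
  shows quotient_lift_coset: "x \<in> carrier M \<Longrightarrow> quotient_lift f (span_of K M S +>\<^bsub>M\<^esub> x) = f x"
    and linear_map_quotient_lift: "linear_map K (quotient_module M (span_of K M S)) W (quotient_lift f)"
proof -
  interpret M: module K M by fact
  interpret W: module K W by fact
  let ?N = "span_of K M S"
  have N: "submodule ?N K M"
    using S by (intro submodule_span_of M) auto
  interpret N: submodule ?N K M by fact
  interpret abelian_subgroup ?N M
    by (intro abelian_subgroupI3 additive_subgroupI N.subgroup_axioms M.abelian_group_axioms)
  have lift: "quotient_lift f (?N +>\<^bsub>M\<^esub> x) = f x" if x: "x \<in> carrier M" for x
  proof -
    have "(SOME a. a \<in> ?N +>\<^bsub>M\<^esub> x) \<in> ?N +>\<^bsub>M\<^esub> x"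
      by (rule someI) (rule a_rcos_self[OF x])
    then obtain n where n: "n \<in> ?N" "(SOME a. a \<in> ?N +>\<^bsub>M\<^esub> x) = n \<oplus>\<^bsub>M\<^esub> x"
      by (auto simp: a_r_coset_def r_coset_def)
    moreover have "f n = \<zero>\<^bsub>W\<^esub>"
      by (rule linear_map_zero_on_span[OF M W f S n(1)])
    ultimately show ?thesis
      using x f a_subset by (simp add: quotient_lift_def linear_map_add[OF f] subset_iff linear_map_closed[OF f])
  qed
  then show "x \<in> carrier M \<Longrightarrow> quotient_lift f (?N +>\<^bsub>M\<^esub> x) = f x" .
  note q = linear_map_quotient[OF M N]
  show "linear_map K (quotient_module M ?N) W (quotient_lift f)"
    by (rule linear_mapI)
      (auto simp: quotient_module_carrier[OF M N] lift linear_map_closed[OF f]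
        linear_map_add[OF q, symmetric] linear_map_smult[OF q, symmetric]
        linear_map_add[OF f] linear_map_smult[OF f])
qed


section \<open>Direct sums\<close>

lemma direct_sum_eqI:
  "\<lbrakk>f \<in> carrier (direct_sum I M); g \<in> carrier (direct_sum I M); \<And>i. i \<in> I \<Longrightarrow> f i = g i\<rbrakk> \<Longrightarrow> f = g"
  by (auto simp: direct_sum_def intro: PiE_ext)

lemma direct_sum_app:
  assumes "i \<in> I"
  shows "f \<in> carrier (direct_sum I M) \<Longrightarrow> f i \<in> carrier (M i)"
    and "\<zero>\<^bsub>direct_sum I M\<^esub> i = \<zero>\<^bsub>M i\<^esub>"
    and "(f \<oplus>\<^bsub>direct_sum I M\<^esub> g) i = f i \<oplus>\<^bsub>M i\<^esub> g i"
    and "(c \<odot>\<^bsub>direct_sum I M\<^esub> f) i = c \<odot>\<^bsub>M i\<^esub> f i"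
  using assms by (auto simp: direct_sum_def)

text \<open>The set \<open>A\<close> only has to contain the support, so sums, multiples and
  translates can be bounded without computing their exact supports.\<close>

lemma direct_sum_restrictI:
  assumes "\<And>i. i \<in> I \<Longrightarrow> f i \<in> carrier (M i)" and "finite A" "\<And>i. \<lbrakk>i \<in> I; i \<notin> A\<rbrakk> \<Longrightarrow> f i = \<zero>\<^bsub>M i\<^esub>"
  shows "(\<lambda>i\<in>I. f i) \<in> carrier (direct_sum I M)"
proof -
  have "finite {i \<in> I. f i \<noteq> \<zero>\<^bsub>M i\<^esub>}"
    by (rule finite_subset[OF _ assms(2)]) (use assms(3) in blast)
  moreover have "{i \<in> I. (\<lambda>i\<in>I. f i) i \<noteq> \<zero>\<^bsub>M i\<^esub>} = {i \<in> I. f i \<noteq> \<zero>\<^bsub>M i\<^esub>}"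
    by auto
  ultimately show ?thesis
    using assms(1) by (simp add: direct_sum_def)
qed

lemma direct_sum_support:
  "f \<in> carrier (direct_sum I M) \<Longrightarrow> finite {i \<in> I. f i \<noteq> \<zero>\<^bsub>M i\<^esub>}"
  by (simp add: direct_sum_def)

lemma module_direct_sum:
  assumes K: "cring K" and M: "\<And>i. i \<in> I \<Longrightarrow> module K (M i)"
  shows "module K (direct_sum I M)"
proof -
  let ?D = "direct_sum I M"
  have ag: "abelian_group (M i)" if "i \<in> I" for i
    using M[OF that] by (simp add: module_def)
  note am = abelian_group.axioms(1)[OF ag]
  note [simp] = direct_sum_app
  have add: "f \<oplus>\<^bsub>?D\<^esub> g \<in> carrier ?D" if "f \<in> carrier ?D" "g \<in> carrier ?D" for f g
  proof -
    have "(\<lambda>i\<in>I. f i \<oplus>\<^bsub>M i\<^esub> g i) \<in> carrier ?D"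
      by (rule direct_sum_restrictI[OF _ finite_UnI[OF direct_sum_support[OF that(1)] direct_sum_support[OF that(2)]]])
        (use am that in \<open>auto simp: abelian_monoid.l_zero abelian_monoid.zero_closed abelian_monoid.a_closed\<close>)
    then show ?thesis by (simp add: direct_sum_def)
  qed
  have smult: "c \<odot>\<^bsub>?D\<^esub> f \<in> carrier ?D" if "c \<in> carrier K" "f \<in> carrier ?D" for c f
  proof -
    have "(\<lambda>i\<in>I. c \<odot>\<^bsub>M i\<^esub> f i) \<in> carrier ?D"
      by (rule direct_sum_restrictI[OF _ direct_sum_support[OF that(2)]])
        (use that in \<open>auto simp: module.smult_closed[OF M] module.smult_r_null[OF M]\<close>)
    then show ?thesis by (simp add: direct_sum_def)
  qed
  have zero: "\<zero>\<^bsub>?D\<^esub> \<in> carrier ?D"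
    using direct_sum_restrictI[of I "\<lambda>i. \<zero>\<^bsub>M i\<^esub>" M "{}"] am
    by (simp add: direct_sum_def abelian_monoid.zero_closed)
  have "abelian_group ?D"
  proof (rule abelian_groupI)
    fix f assume f: "f \<in> carrier ?D"
    let ?g = "\<lambda>i\<in>I. \<ominus>\<^bsub>M i\<^esub> f i"
    have a_inv_zero: "\<ominus>\<^bsub>M i\<^esub> \<zero>\<^bsub>M i\<^esub> = \<zero>\<^bsub>M i\<^esub>" if "i \<in> I" for i
      using monoid.inv_one[OF abelian_monoid.a_monoid[OF am[OF that]]] by (simp add: a_inv_def)
    have g: "?g \<in> carrier ?D"
      by (rule direct_sum_restrictI[OF _ direct_sum_support[OF f]])
        (use f in \<open>auto simp: a_inv_zero abelian_group.a_inv_closed[OF ag]\<close>)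
    then have "?g \<oplus>\<^bsub>?D\<^esub> f = \<zero>\<^bsub>?D\<^esub>"
      by (intro direct_sum_eqI[OF add[OF _ f] zero])
        (use f in \<open>auto simp: abelian_group.l_neg[OF ag]\<close>)
    with g show "\<exists>g\<in>carrier ?D. g \<oplus>\<^bsub>?D\<^esub> f = \<zero>\<^bsub>?D\<^esub>" by blast
  qed (auto intro!: direct_sum_eqI[where I = I and M = M] intro: add zero
      simp: abelian_monoid.a_assoc[OF am] abelian_monoid.a_comm[OF am] abelian_monoid.l_zero[OF am])
  then show ?thesis
    by (rule moduleI[OF K])
      (auto intro!: direct_sum_eqI[where I = I and M = M] add smult cring.cring_simprules[OF K]
        simp: module.smult_l_distr[OF M] module.smult_r_distr[OF M] module.smult_assoc1[OF M]
          module.smult_one[OF M])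
qed

lemma linear_map_summand:
  assumes M: "\<And>i. i \<in> I \<Longrightarrow> module K (M i)" and i: "i \<in> I"
  shows "linear_map K (M i) (direct_sum I M) (summand I M i)"
proof -
  have am: "abelian_monoid (M j)" if "j \<in> I" for j
    using M[OF that] by (simp add: module_def abelian_group_def)
  show ?thesis
  proof (rule linear_mapI)
    show "summand I M i x \<in> carrier (direct_sum I M)" if "x \<in> carrier (M i)" for x
      unfolding summand_def
      by (rule direct_sum_restrictI[where A = "{i}"])
        (use that in \<open>auto simp: abelian_monoid.zero_closed[OF am]\<close>)
    show "summand I M i (x \<oplus>\<^bsub>M i\<^esub> y) = summand I M i x \<oplus>\<^bsub>direct_sum I M\<^esub> summand I M i y" for x y
      unfolding summand_def direct_sum_def
      by (simp, rule restrict_ext) (auto simp: abelian_monoid.l_zero[OF am] abelian_monoid.zero_closed[OF am])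
    show "summand I M i (c \<odot>\<^bsub>M i\<^esub> x) = c \<odot>\<^bsub>direct_sum I M\<^esub> summand I M i x" if "c \<in> carrier K" for c x
      unfolding summand_def direct_sum_def
      by (simp, rule restrict_ext) (use that in \<open>auto simp: module.smult_r_null[OF M]\<close>)
  qed
qed

lemma summand_closed:
  "\<lbrakk>\<And>i. i \<in> I \<Longrightarrow> module K (M i); i \<in> I; x \<in> carrier (M i)\<rbrakk> \<Longrightarrow> summand I M i x \<in> carrier (direct_sum I M)"
  by (rule linear_map_closed[OF linear_map_summand])

text \<open>Induction on a finite set bounding the support. The family \<open>?g\<close> is
  \<open>f\<close> with the component at \<open>a\<close> erased, and \<open>f\<close> is recovered
  by adding that component back as a summand. Such a summand lies in \<open>N\<close> because the
  preimage of \<open>N\<close> in \<open>M a\<close> is a submodule containing the generators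
  \<open>S a\<close>.\<close>

lemma generates_direct_sum:
  assumes K: "cring K" and M: "\<And>i. i \<in> I \<Longrightarrow> module K (M i)"
    and S: "\<And>i. i \<in> I \<Longrightarrow> generates K (M i) (S i)"
  shows "generates K (direct_sum I M) (\<Union>i\<in>I. summand I M i ` S i)"
  unfolding generates_def
proof (intro conjI allI impI)
  let ?D = "direct_sum I M"
  interpret D: module K ?D
    by (rule module_direct_sum[OF K M])
  show "(\<Union>i\<in>I. summand I M i ` S i) \<subseteq> carrier ?D"
    using S by (auto simp: generates_def intro!: summand_closed[OF M])
  fix N assume N: "submodule N K ?D" and sub: "(\<Union>i\<in>I. summand I M i ` S i) \<subseteq> N"
  have summand_N: "summand I M i x \<in> N" if i: "i \<in> I" "x \<in> carrier (M i)" for i x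
  proof -
    have "submodule {x \<in> carrier (M i). summand I M i x \<in> N} K (M i)"
      by (rule submodule_vimage[OF M D.module_axioms linear_map_summand[OF M] N]) (use i in auto)
    from generates_subset[OF S[OF i(1)] this _ i(2)] show ?thesis
      using S[OF i(1)] sub i(1) by (auto simp: generates_def)
  qed
  have am: "abelian_monoid (M j)" if "j \<in> I" for j
    using M[OF that] by (simp add: module_def abelian_group_def)
  have zero_N: "\<zero>\<^bsub>?D\<^esub> \<in> N"
    using subgroup.one_closed[OF submodule.axioms(1)[OF N]] by simp
  have "f \<in> N" if "finite A" "f \<in> carrier ?D" "{i \<in> I. f i \<noteq> \<zero>\<^bsub>M i\<^esub>} \<subseteq> A" for A f
    using that
  proof (induction A arbitrary: f)
    case empty
    then have "f = \<zero>\<^bsub>?D\<^esub>"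
      by (intro direct_sum_eqI[where I = I and M = M]) (auto simp: direct_sum_app)
    then show ?case using zero_N by simp
  next
    case (insert a A)
    show ?case
    proof (cases "a \<in> I")
      case False
      with insert show ?thesis by (intro insert.IH) auto
    next
      case True
      let ?g = "\<lambda>i\<in>I. if i = a then \<zero>\<^bsub>M i\<^esub> else f i"
      have g: "?g \<in> carrier ?D"
        by (rule direct_sum_restrictI[OF _ direct_sum_support[OF insert.prems(1)]])
          (use insert.prems in \<open>auto simp: abelian_monoid.zero_closed[OF am] direct_sum_app\<close>)
      have "?g \<in> N"
        by (rule insert.IH[OF g]) (use insert.prems(2) in auto)
      moreover have fa: "f a \<in> carrier (M a)"
        using insert.prems True by (simp add: direct_sum_app)
      moreover have "f = ?g \<oplus>\<^bsub>?D\<^esub> summand I M a (f a)"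
        by (rule direct_sum_eqI[OF insert.prems(1) D.a_closed[OF g summand_closed[where M = M, OF M True fa]]])
          (use insert.prems True in \<open>auto simp: direct_sum_app summand_def
            abelian_monoid.l_zero[OF am] abelian_monoid.r_zero[OF am]\<close>)
      ultimately show ?thesis
        using D.submoduleE(5)[OF N _ summand_N[OF True fa]] by metis
    qed
  qed
  then show "carrier ?D \<subseteq> N"
    by (auto simp: direct_sum_def)
qed

lemma generates_carrier: "generates K M (carrier M)"
  by (auto simp: generates_def)

lemmas generates_summands = generates_direct_sum[OF _ _ generates_carrier]

text \<open>The map out of the direct sum given by its universal property. Summing over the support
  of \<open>f\<close> keeps the range finite for every \<open>I\<close>, at the price of a range
  that varies with \<open>f\<close>.\<close>

definition direct_sum_lift ::
    "('k, 'b, 's) module_scheme \<Rightarrow> 'i set \<Rightarrow> ('i \<Rightarrow> ('k, 'a) module) \<Rightarrow> ('i \<Rightarrow> 'a \<Rightarrow> 'b) \<Rightarrow> ('i \<Rightarrow> 'a) \<Rightarrow> 'b"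
  where "direct_sum_lift W I M h f = (\<Oplus>\<^bsub>W\<^esub>i\<in>{i \<in> I. f i \<noteq> \<zero>\<^bsub>M i\<^esub>}. h i (f i))"

lemma direct_sum_lift:
  assumes M: "\<And>i. i \<in> I \<Longrightarrow> module K (M i)" and W: "module K W"
    and h: "\<And>i. i \<in> I \<Longrightarrow> linear_map K (M i) W (h i)"
  shows linear_map_direct_sum_lift: "linear_map K (direct_sum I M) W (direct_sum_lift W I M h)"
    and direct_sum_lift_summand: "\<lbrakk>i \<in> I; x \<in> carrier (M i)\<rbrakk> \<Longrightarrow>
      direct_sum_lift W I M h (summand I M i x) = h i x"
proof -
  interpret W: module K W by fact
  let ?D = "direct_sum I M" and ?l = "direct_sum_lift W I M h" 
  let ?s = "\<lambda>f. {i \<in> I. f i \<noteq> \<zero>\<^bsub>M i\<^esub>}"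
  interpret D: module K ?D
    by (rule module_direct_sum[OF module_cring[OF W] M])
  have am: "abelian_monoid (M j)" if "j \<in> I" for j
    using M[OF that] by (simp add: module_def abelian_group_def)
  have Dc: "f i \<in> carrier (M i)" "finite (?s f)" if "f \<in> carrier ?D" "i \<in> I" for f i
    using that by (auto simp: direct_sum_def)
  have hz: "h i \<zero>\<^bsub>M i\<^esub> = \<zero>\<^bsub>W\<^esub>" if "i \<in> I" for i
    using linear_map_zero[OF M[OF that] W h[OF that]] .
  have hc: "h i (f i) \<in> carrier W" if "f \<in> carrier ?D" "i \<in> I" for f i
    using linear_map_closed[OF h] Dc that by blast
  \<comment> \<open>The range may grow to any finite set between the support and \<open>I\<close>,
    as \<open>h i\<close> sends zero to zero. Additivity then compares three sums over the union of
    two supports.\<close>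
  have eq: "?l f = (\<Oplus>\<^bsub>W\<^esub>i\<in>A. h i (f i))" if "f \<in> carrier ?D" "finite A" "?s f \<subseteq> A" "A \<subseteq> I" for f A
    unfolding direct_sum_lift_def
    by (rule W.add.finprod_mono_neutral_cong_left) (use that hc hz in auto)
  show "linear_map K ?D W ?l"
  proof (rule linear_mapI)
    show "?l f \<in> carrier W" if "f \<in> carrier ?D" for f
      unfolding direct_sum_lift_def by (rule W.finsum_closed) (use that hc in auto)
  next
    fix f g assume fg: "f \<in> carrier ?D" "g \<in> carrier ?D"
    let ?A = "?s f \<union> ?s g"
    have A: "finite ?A" using fg by (auto simp: direct_sum_def)
    have s: "?s (f \<oplus>\<^bsub>?D\<^esub> g) \<subseteq> ?A"
      using am by (auto simp: direct_sum_def abelian_monoid.l_zero abelian_monoid.zero_closed)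
    have AI: "?A \<subseteq> I" by blast
    have "?l (f \<oplus>\<^bsub>?D\<^esub> g) = (\<Oplus>\<^bsub>W\<^esub>i\<in>?A. h i ((f \<oplus>\<^bsub>?D\<^esub> g) i))"
      by (rule eq[OF D.a_closed[OF fg] A s AI])
    also have "\<dots> = (\<Oplus>\<^bsub>W\<^esub>i\<in>?A. h i (f i) \<oplus>\<^bsub>W\<^esub> h i (g i))"
      by (rule W.finsum_cong')
        (use fg in \<open>auto simp: direct_sum_app linear_map_add[OF h] hc\<close>)
    also have "\<dots> = (\<Oplus>\<^bsub>W\<^esub>i\<in>?A. h i (f i)) \<oplus>\<^bsub>W\<^esub> (\<Oplus>\<^bsub>W\<^esub>i\<in>?A. h i (g i))"
      by (rule W.finsum_addf) (use fg hc in auto)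
    also have "\<dots> = ?l f \<oplus>\<^bsub>W\<^esub> ?l g"
      by (simp only: eq[OF fg(1) A Un_upper1 AI] eq[OF fg(2) A Un_upper2 AI])
    finally show "?l (f \<oplus>\<^bsub>?D\<^esub> g) = ?l f \<oplus>\<^bsub>W\<^esub> ?l g" .
  next
    fix c f assume cf: "c \<in> carrier K" "f \<in> carrier ?D"
    have A: "finite (?s f)" using cf by (auto simp: direct_sum_def)
    have s: "?s (c \<odot>\<^bsub>?D\<^esub> f) \<subseteq> ?s f"
      using cf by (auto simp: direct_sum_app module.smult_r_null[OF M])
    have "?l (c \<odot>\<^bsub>?D\<^esub> f) = (\<Oplus>\<^bsub>W\<^esub>i\<in>?s f. h i ((c \<odot>\<^bsub>?D\<^esub> f) i))"
      by (rule eq[OF D.smult_closed[OF cf] A s]) blast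
    also have "\<dots> = (\<Oplus>\<^bsub>W\<^esub>i\<in>?s f. c \<odot>\<^bsub>W\<^esub> h i (f i))"
      by (rule W.finsum_cong')
        (use cf in \<open>auto simp: direct_sum_app linear_map_smult[OF h] hc\<close>)
    also have "\<dots> = c \<odot>\<^bsub>W\<^esub> ?l f"
      unfolding direct_sum_lift_def
      by (rule W.finsum_smult_ldistr[symmetric]) (use cf hc A in auto)
    finally show "?l (c \<odot>\<^bsub>?D\<^esub> f) = c \<odot>\<^bsub>W\<^esub> ?l f" .
  qed
  show "?l (summand I M i x) = h i x" if i: "i \<in> I" and x: "x \<in> carrier (M i)"
  proof -
    have "?l (summand I M i x) = (\<Oplus>\<^bsub>W\<^esub>j\<in>{i}. h j (summand I M i x j))"
      by (rule eq) (use i x summand_closed[where M = M, OF M i x] in \<open>auto simp: summand_def\<close>)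
    also have "\<dots> = h i x"
      using i x linear_map_closed[OF h] by (simp add: summand_def)
    finally show ?thesis .
  qed
qed

section \<open>Bilinear maps on direct sums\<close>

lemma bilinear_map_swap: "bilinear_map K U V W h \<Longrightarrow> bilinear_map K V U W (\<lambda>x y. h y x)"
  by (auto simp: bilinear_map_def)

lemma linear_map_pointwise_add:
  assumes "module K W" "linear_map K V W f" "linear_map K V W g"
  shows "linear_map K V W (\<lambda>x. f x \<oplus>\<^bsub>W\<^esub> g x)"
proof -
  interpret W: module K W by fact
  show ?thesis
    using assms(2,3)
    by (intro linear_mapI) (auto simp: linear_map_add linear_map_smult linear_map_closed
        W.smult_r_distr W.a_ac)
qed

text \<open>Commutativity of \<open>K\<close> enters here: \<open>c\<close> has to be moved past the
  scalar pulled out of the argument.\<close>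

lemma linear_map_pointwise_smult:
  assumes "module K W" "linear_map K V W f" "c \<in> carrier K"
  shows "linear_map K V W (\<lambda>x. c \<odot>\<^bsub>W\<^esub> f x)"
proof -
  interpret W: module K W by fact
  show ?thesis
    using assms(2,3)
    by (intro linear_mapI) (auto simp: linear_map_add linear_map_smult linear_map_closed
        W.smult_r_distr W.smult_assoc1[symmetric] W.R.m_comm)
qed

text \<open>Linearity in \<open>y\<close> is an equality between two maps that are linear in
  \<open>f\<close>. It is therefore enough to check it on summands, where it is the linearity of
  \<open>h i\<close> in its second argument.\<close>

lemma bilinear_map_direct_sum_lift:
  assumes M: "\<And>i. i \<in> I \<Longrightarrow> module K (M i)" and V: "module K V" and W: "module K W"
    and h: "\<And>i. i \<in> I \<Longrightarrow> bilinear_map K (M i) V W (h i)"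
  shows "bilinear_map K (direct_sum I M) V W (\<lambda>f y. direct_sum_lift W I M (\<lambda>i x. h i x y) f)"
proof -
  interpret V: module K V by fact
  interpret W: module K W by fact
  let ?l = "\<lambda>y. direct_sum_lift W I M (\<lambda>i x. h i x y)"
  note gen = generates_summands[OF module_cring[OF W] M]
  note D = module_direct_sum[OF module_cring[OF W] M]
  have l: "linear_map K (direct_sum I M) W (?l y)" if "y \<in> carrier V" for y
    by (rule linear_map_direct_sum_lift[OF M W bilinear_mapD(2)[OF h that]])
  have ls: "?l y (summand I M i x) = h i x y" if "y \<in> carrier V" "i \<in> I" "x \<in> carrier (M i)" for y i x
    by (rule direct_sum_lift_summand[where M = M and h = "\<lambda>i x. h i x y", OF M W bilinear_mapD(2)[OF h that(1)] that(2,3)])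
  have "linear_map K V W (\<lambda>y. ?l y f)" if f: "f \<in> carrier (direct_sum I M)" for f
  proof (rule linear_mapI)
    show "?l y f \<in> carrier W" if "y \<in> carrier V" for y
      using linear_map_closed[OF l[OF that] f] .
  next
    fix y y' assume y: "y \<in> carrier V" "y' \<in> carrier V"
    show "?l (y \<oplus>\<^bsub>V\<^esub> y') f = ?l y f \<oplus>\<^bsub>W\<^esub> ?l y' f"
      by (rule linear_map_eq[where f = "?l (y \<oplus>\<^bsub>V\<^esub> y')" and g = "\<lambda>f. ?l y f \<oplus>\<^bsub>W\<^esub> ?l y' f", OF gen D W _ _ _ f])
        (use y in \<open>auto intro!: l linear_map_pointwise_add[OF W] simp: ls linear_map_add[OF bilinear_mapD(1)[OF h]]\<close>)
  next
    fix c y assume y: "c \<in> carrier K" "y \<in> carrier V"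
    show "?l (c \<odot>\<^bsub>V\<^esub> y) f = c \<odot>\<^bsub>W\<^esub> ?l y f"
      by (rule linear_map_eq[where f = "?l (c \<odot>\<^bsub>V\<^esub> y)" and g = "\<lambda>f. c \<odot>\<^bsub>W\<^esub> ?l y f", OF gen D W _ _ _ f])
        (use y in \<open>auto intro!: l linear_map_pointwise_smult[OF W] simp: ls linear_map_smult[OF bilinear_mapD(1)[OF h]]\<close>)
  qed
  with l show ?thesis
    by (simp add: bilinear_map_def)
qed

text \<open>Two successive lifts, over \<open>J\<close> and then over \<open>I\<close>. The maps
  \<open>h i j\<close> need not be compatible with each other, which is what makes a composition
  easy to prescribe on graded morphisms.\<close>

lemma direct_sum_bilinear_extension:
  assumes M: "\<And>i. i \<in> I \<Longrightarrow> module K (M i)" and N: "\<And>j. j \<in> J \<Longrightarrow> module K (N j)"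
    and W: "module K W"
    and h: "\<And>i j. \<lbrakk>i \<in> I; j \<in> J\<rbrakk> \<Longrightarrow> bilinear_map K (M i) (N j) W (h i j)"
  obtains H where "bilinear_map K (direct_sum I M) (direct_sum J N) W H"
    and "\<And>i j x y. \<lbrakk>i \<in> I; j \<in> J; x \<in> carrier (M i); y \<in> carrier (N j)\<rbrakk> \<Longrightarrow>
      H (summand I M i x) (summand J N j y) = h i j x y"
proof -
  interpret W: module K W by fact
  note DN = module_direct_sum[OF module_cring[OF W] N]
  define L where "L = (\<lambda>i x g. direct_sum_lift W J N (\<lambda>j y. h i j x y) g)"
  define H where "H = (\<lambda>f g. direct_sum_lift W I M (\<lambda>i x. L i x g) f)"
  have L: "bilinear_map K (M i) (direct_sum J N) W (L i)" if "i \<in> I" for i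
  proof -
    have "bilinear_map K (direct_sum J N) (M i) W (\<lambda>g x. direct_sum_lift W J N (\<lambda>j y. h i j x y) g)"
      by (rule bilinear_map_direct_sum_lift[OF N M[OF that] W, where h = "\<lambda>j y x. h i j x y"])
        (auto intro: bilinear_map_swap[OF h[OF that]])
    then show ?thesis
      unfolding L_def by (rule bilinear_map_swap)
  qed
  have "bilinear_map K (direct_sum I M) (direct_sum J N) W H"
    unfolding H_def by (rule bilinear_map_direct_sum_lift[OF M DN W L])
  moreover have "H (summand I M i x) (summand J N j y) = h i j x y"
    if "i \<in> I" "j \<in> J" "x \<in> carrier (M i)" "y \<in> carrier (N j)" for i j x y
  proof -
    have "H (summand I M i x) (summand J N j y) = L i x (summand J N j y)"
      unfolding H_def
      by (rule direct_sum_lift_summand[where M = M and h = "\<lambda>i x. L i x (summand J N j y)",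
            OF M W bilinear_mapD(2)[OF L summand_closed[where M = N, OF N that(2,4)]] that(1,3)])
    also have "\<dots> = h i j x y"
      unfolding L_def
      by (rule direct_sum_lift_summand[where M = N and h = "\<lambda>j. h i j x",
            OF N W bilinear_mapD(1)[OF h[OF that(1)] that(3)] that(2,4)])
    finally show ?thesis .
  qed
  ultimately show ?thesis by (rule that)
qed


section \<open>Tensor products\<close>

lemma module_self: "cring K \<Longrightarrow> module K (self_module K)"
proof -
  assume "cring K"
  then interpret cring K .
  show ?thesis
    by (intro moduleI abelian_groupI cring_axioms)
      (auto simp: self_module_def a_ac m_assoc l_distr r_distr intro: l_neg)
qed

lemma generates_self:
  assumes "cring K"
  shows "generates K (self_module K) {\<one>\<^bsub>K\<^esub>}"
proof -
  interpret cring K by fact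
  show ?thesis
    unfolding generates_def
  proof (intro conjI allI impI)
    fix N assume N: "submodule N K (self_module K)" and one: "{\<one>\<^bsub>K\<^esub>} \<subseteq> N"
    show "carrier (self_module K) \<subseteq> N"
    proof
      fix c assume c: "c \<in> carrier (self_module K)"
      then have "c \<odot>\<^bsub>self_module K\<^esub> \<one>\<^bsub>K\<^esub> \<in> N"
        using one by (intro submodule.smult_closed[OF N]) (auto simp: self_module_def)
      with c show "c \<in> N" by (simp add: self_module_def)
    qed
  qed (simp add: self_module_def)
qed

section \<open>Free modules and their universal property\<close>

lemma free_module_facts:
  assumes K: "cring K"
  shows module_free: "module K (free_module K S)"
    and free_basis_closed: "s \<in> S \<Longrightarrow> free_basis K S s \<in> carrier (free_module K S)"
    and generates_free: "generates K (free_module K S) (free_basis K S ` S)"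
proof -
  note m = module_self[OF K]
  show "module K (free_module K S)"
    unfolding free_module_def by (rule module_direct_sum[OF K m])
  show "free_basis K S s \<in> carrier (free_module K S)" if "s \<in> S"
    unfolding free_basis_def free_module_def
    by (rule summand_closed[OF m that]) (simp add: self_module_def cring.cring_simprules[OF K])
  show "generates K (free_module K S) (free_basis K S ` S)"
    using generates_direct_sum[OF K m generates_self[OF K], of S]
    by (simp add: free_module_def free_basis_def image_image UNION_singleton_eq_range)
qed

lemma free_module_lift:
  assumes W: "module K W" and b: "\<And>s. s \<in> S \<Longrightarrow> b s \<in> carrier W"
  obtains f where "linear_map K (free_module K S) W f" "\<And>s. s \<in> S \<Longrightarrow> f (free_basis K S s) = b s"
proof
  interpret W: module K W by fact
  let ?h = "\<lambda>s c. c \<odot>\<^bsub>W\<^esub> b s"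
  note m = module_self[OF module_cring[OF W]]
  have h: "linear_map K (self_module K) W (?h s)" if "s \<in> S" for s
    using b[OF that] by (intro linear_mapI) (auto simp: self_module_def W.smult_l_distr W.smult_assoc1)
  show "linear_map K (free_module K S) W (direct_sum_lift W S (\<lambda>_. self_module K) ?h)"
    unfolding free_module_def by (rule linear_map_direct_sum_lift[OF m W h])
  show "direct_sum_lift W S (\<lambda>_. self_module K) ?h (free_basis K S s) = b s" if "s \<in> S" for s
    unfolding free_basis_def
    by (subst direct_sum_lift_summand[where h = ?h, OF m W h])
      (use that b in \<open>auto simp: self_module_def\<close>)
qed

section \<open>The universal property of the tensor product\<close>

context
  fixes K :: "('k, 'r) ring_scheme" and V :: "('k, 'a) module" and W :: "('k, 'b) module"
  assumes V: "module K V" and W: "module K W"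
begin

lemma tensor_relations_closed:
  "tensor_relations K V W \<subseteq> carrier (free_module K (carrier V \<times> carrier W))"
proof -
  interpret V: module K V by (fact V)
  interpret W: module K W by (fact W)
  note e = free_basis_closed[OF module_cring[OF V]]
  interpret F: module K "free_module K (carrier V \<times> carrier W)"
    by (rule module_free[OF module_cring[OF V]])
  show ?thesis
    by (auto simp: tensor_relations_def Let_def intro!: F.minus_closed F.a_closed F.smult_closed e)
qed

lemma tensor_span_submodule:
  "submodule (span_of K (free_module K (carrier V \<times> carrier W)) (tensor_relations K V W)) K
    (free_module K (carrier V \<times> carrier W))"
  by (rule submodule_span_of[OF module_free[OF module_cring[OF V]] tensor_relations_closed])

lemma module_tensor_product: "module K (tensor_product K V W)"
  unfolding tensor_product_def Let_def
  by (rule module_quotient[OF module_free[OF module_cring[OF V]] tensor_span_submodule])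

text \<open>Each of the four families in \<open>tensor_relations\<close> turns into one of the four
  identities of bilinearity when cosets are taken.\<close>

lemma bilinear_map_pure_tensor: "bilinear_map K V W (tensor_product K V W) (pure_tensor K V W)"
proof -
  interpret V: module K V by (fact V)
  interpret W: module K W by (fact W)
  let ?S = "carrier V \<times> carrier W" let ?F = "free_module K ?S" let ?e = "free_basis K ?S"
  let ?N = "span_of K ?F (tensor_relations K V W)" let ?T = "tensor_product K V W"
  have F: "module K ?F" by (rule module_free[OF module_cring[OF V]])
  then interpret F: module K ?F .
  note e = free_basis_closed[OF module_cring[OF V], of _ ?S]
  have p: "linear_map K ?F ?T (\<lambda>x. ?N +>\<^bsub>?F\<^esub> x)"
    unfolding tensor_product_def Let_def by (rule linear_map_quotient[OF F tensor_span_submodule])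
  have eq: "?N +>\<^bsub>?F\<^esub> x = ?N +>\<^bsub>?F\<^esub> y"
    if "x \<ominus>\<^bsub>?F\<^esub> y \<in> tensor_relations K V W" "x \<in> carrier ?F" "y \<in> carrier ?F" for x y
    using that span_of_superset[of "tensor_relations K V W" K ?F]
    by (intro coset_eqI[OF F tensor_span_submodule]) auto
  have t: "pure_tensor K V W v w = ?N +>\<^bsub>?F\<^esub> ?e (v, w)" for v w
    by (simp add: pure_tensor_def Let_def)
  note add = linear_map_add[OF p, symmetric] and smult = linear_map_smult[OF p, symmetric]
  show ?thesis
    unfolding bilinear_map_def
  proof (intro conjI ballI linear_mapI)
    fix v w w' assume vw: "v \<in> carrier V" "w \<in> carrier W" "w' \<in> carrier W"
    then have "?e (v, w \<oplus>\<^bsub>W\<^esub> w') \<ominus>\<^bsub>?F\<^esub> (?e (v, w) \<oplus>\<^bsub>?F\<^esub> ?e (v, w')) \<in> tensor_relations K V W"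
      unfolding tensor_relations_def Let_def by blast
    from eq[OF this] vw
    show "pure_tensor K V W v (w \<oplus>\<^bsub>W\<^esub> w') = pure_tensor K V W v w \<oplus>\<^bsub>?T\<^esub> pure_tensor K V W v w'"
      by (simp add: t add e)
  next
    fix v v' w assume vw: "v \<in> carrier V" "v' \<in> carrier V" "w \<in> carrier W"
    then have "?e (v \<oplus>\<^bsub>V\<^esub> v', w) \<ominus>\<^bsub>?F\<^esub> (?e (v, w) \<oplus>\<^bsub>?F\<^esub> ?e (v', w)) \<in> tensor_relations K V W"
      unfolding tensor_relations_def Let_def by blast
    from eq[OF this] vw
    show "pure_tensor K V W (v \<oplus>\<^bsub>V\<^esub> v') w = pure_tensor K V W v w \<oplus>\<^bsub>?T\<^esub> pure_tensor K V W v' w"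
      by (simp add: t add e)
  next
    fix v c w assume vw: "v \<in> carrier V" "c \<in> carrier K" "w \<in> carrier W"
    then have "?e (v, c \<odot>\<^bsub>W\<^esub> w) \<ominus>\<^bsub>?F\<^esub> c \<odot>\<^bsub>?F\<^esub> ?e (v, w) \<in> tensor_relations K V W"
      and "?e (c \<odot>\<^bsub>V\<^esub> v, w) \<ominus>\<^bsub>?F\<^esub> c \<odot>\<^bsub>?F\<^esub> ?e (v, w) \<in> tensor_relations K V W"
      unfolding tensor_relations_def Let_def by blast+
    from eq[OF this(1)] eq[OF this(2)] vw
    show "pure_tensor K V W v (c \<odot>\<^bsub>W\<^esub> w) = c \<odot>\<^bsub>?T\<^esub> pure_tensor K V W v w"
      and "pure_tensor K V W (c \<odot>\<^bsub>V\<^esub> v) w = c \<odot>\<^bsub>?T\<^esub> pure_tensor K V W v w"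
      by (simp_all add: t smult e)
  qed (auto simp: t intro!: linear_map_closed[OF p] e)
qed

lemma generates_tensor_product:
  "generates K (tensor_product K V W) {pure_tensor K V W v w |v w. v \<in> carrier V \<and> w \<in> carrier W}"
proof -
  let ?S = "carrier V \<times> carrier W" let ?F = "free_module K ?S"
  let ?N = "span_of K ?F (tensor_relations K V W)"
  have F: "module K ?F" by (rule module_free[OF module_cring[OF V]])
  have "generates K (quotient_module ?F ?N) ((\<lambda>x. ?N +>\<^bsub>?F\<^esub> x) ` (free_basis K ?S ` ?S))"
    by (rule generates_image[OF F module_quotient[OF F tensor_span_submodule]
          linear_map_quotient[OF F tensor_span_submodule]
          quotient_module_carrier[OF F tensor_span_submodule, symmetric]
          generates_free[OF module_cring[OF V]]])
  moreover have "(\<lambda>x. ?N +>\<^bsub>?F\<^esub> x) ` (free_basis K ?S ` ?S) =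
      {pure_tensor K V W v w |v w. v \<in> carrier V \<and> w \<in> carrier W}"
    by (auto simp: pure_tensor_def Let_def)
  ultimately show ?thesis
    by (simp add: tensor_product_def Let_def)
qed

text \<open>The values of \<open>b\<close> on pairs extend linearly to the free module on
  \<open>carrier V \<times> carrier W\<close>. Bilinearity of \<open>b\<close> says exactly that
  this extension kills the relations, so it descends to the quotient.\<close>

lemma tensor_product_lift:
  assumes U: "module K U" and b: "bilinear_map K V W U b"
  obtains f where "linear_map K (tensor_product K V W) U f"
    and "\<And>v w. \<lbrakk>v \<in> carrier V; w \<in> carrier W\<rbrakk> \<Longrightarrow> f (pure_tensor K V W v w) = b v w"
proof -
  interpret V: module K V by (fact V)
  interpret W: module K W by (fact W)
  interpret U: module K U by (fact U)
  let ?S = "carrier V \<times> carrier W" let ?F = "free_module K ?S" let ?e = "free_basis K ?S"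
  have F: "module K ?F" by (rule module_free[OF module_cring[OF V]])
  then interpret F: module K ?F .
  note e = free_basis_closed[OF module_cring[OF V], of _ ?S]
  note bc = bilinear_mapD(3)[OF b]
  obtain g where g: "linear_map K ?F U g"
    and ge: "\<And>s. s \<in> ?S \<Longrightarrow> g (?e s) = (case s of (v, w) \<Rightarrow> b v w)"
    by (rule free_module_lift[OF U, of ?S "\<lambda>(v, w). b v w"]) (auto simp: bc)
  note g' = linear_map_minus[OF F U g] linear_map_add[OF g] linear_map_smult[OF g] ge
  note b' = linear_map_add[OF bilinear_mapD(1)[OF b]] linear_map_smult[OF bilinear_mapD(1)[OF b]]
    linear_map_add[OF bilinear_mapD(2)[OF b]] linear_map_smult[OF bilinear_mapD(2)[OF b]]
  have minus_self: "u \<ominus>\<^bsub>U\<^esub> u = \<zero>\<^bsub>U\<^esub>" if "u \<in> carrier U" for u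
    using that by (simp add: a_minus_def U.r_neg)
  have "g s = \<zero>\<^bsub>U\<^esub>" if "s \<in> tensor_relations K V W" for s
    using that
    by (auto simp: tensor_relations_def Let_def g' e F.a_closed F.smult_closed b' bc minus_self)
  then have kill: "s \<in> carrier ?F \<and> g s = \<zero>\<^bsub>U\<^esub>" if "s \<in> tensor_relations K V W" for s
    using that tensor_relations_closed by blast
  show ?thesis
  proof
    show "linear_map K (tensor_product K V W) U (quotient_lift g)"
      unfolding tensor_product_def Let_def by (rule linear_map_quotient_lift[OF F U g kill])
    show "quotient_lift g (pure_tensor K V W v w) = b v w" if "v \<in> carrier V" "w \<in> carrier W" for v w
      unfolding pure_tensor_def Let_def
      using that by (subst quotient_lift_coset[OF F U g kill]) (auto simp: e ge)
  qed
qed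

end

section \<open>Tensoring with a free module yields a sum of copies\<close>

definition tensor_free_map ::
    "('k, 'r) ring_scheme \<Rightarrow> ('k, 'a) module \<Rightarrow> 'i set \<Rightarrow> ('i \<Rightarrow> 'a) \<Rightarrow> ('a \<times> ('i \<Rightarrow> 'k) \<Rightarrow> 'k) set"
  where "tensor_free_map K V S = direct_sum_lift (tensor_product K V (free_module K S)) S (\<lambda>_. V)
    (\<lambda>s v. pure_tensor K V (free_module K S) v (free_basis K S s))"

text \<open>With \<open>S\<close> the group and \<open>V\<close> a morphism space of the category,
  this compares graded morphisms with the smash morphisms. The inverse is obtained from the
  universal property of the tensor product.\<close>

lemma tensor_free_map:
  assumes V: "module K V"
  shows linear_map_tensor_free_map:
      "linear_map K (direct_sum S (\<lambda>_. V)) (tensor_product K V (free_module K S)) (tensor_free_map K V S)"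
    and tensor_free_map_summand: "\<lbrakk>s \<in> S; v \<in> carrier V\<rbrakk> \<Longrightarrow>
      tensor_free_map K V S (summand S (\<lambda>_. V) s v) = pure_tensor K V (free_module K S) v (free_basis K S s)"
    and bij_betw_tensor_free_map: "bij_betw (tensor_free_map K V S) (carrier (direct_sum S (\<lambda>_. V)))
      (carrier (tensor_product K V (free_module K S)))"
proof -
  interpret V: module K V by fact
  note K = module_cring[OF V] and m = module_self[OF module_cring[OF V]]
  let ?W = "free_module K S" and ?D = "direct_sum S (\<lambda>_. V)" and ?e = "free_basis K S"
  let ?T = "tensor_product K V ?W" and ?t = "pure_tensor K V ?W" and ?\<sigma> = "tensor_free_map K V S"
  let ?\<delta> = "summand S (\<lambda>_. V)"
  have W: "module K ?W" by (rule module_free[OF K])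
  have D: "module K ?D" by (rule module_direct_sum[OF K V])
  have T: "module K ?T" by (rule module_tensor_product[OF V W])
  note t = bilinear_map_pure_tensor[OF V W]
  have te: "linear_map K V ?T (\<lambda>v. ?t v (?e s))" if "s \<in> S" for s
    by (rule bilinear_mapD(2)[OF t free_basis_closed[OF K that]])
  show lin: "linear_map K ?D ?T ?\<sigma>"
    unfolding tensor_free_map_def by (rule linear_map_direct_sum_lift[OF V T te])
  show \<sigma>: "?\<sigma> (?\<delta> s v) = ?t v (?e s)" if "s \<in> S" "v \<in> carrier V" for s v
    unfolding tensor_free_map_def
    by (rule direct_sum_lift_summand[where M = "\<lambda>_. V", OF V T te that])
  \<comment> \<open>The family \<open>b v w\<close> has the component \<open>w s\<close> times
    \<open>v\<close> at \<open>s\<close>; it is the expected image of the tensor of \<open>v\<close>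
    and \<open>w\<close>.\<close>
  define b where "b v w = direct_sum_lift ?D S (\<lambda>_. self_module K) (\<lambda>s c. ?\<delta> s (c \<odot>\<^bsub>V\<^esub> v)) w" for v w
  have "bilinear_map K (self_module K) V V (\<lambda>c v. c \<odot>\<^bsub>V\<^esub> v)"
    unfolding bilinear_map_def
    by (intro conjI ballI linear_mapI)
      (auto simp: self_module_def V.smult_l_distr V.smult_r_distr V.smult_assoc1[symmetric] V.R.m_comm)
  from bilinear_map_compose[OF this linear_map_id linear_map_id linear_map_summand[of S K "\<lambda>_. V", OF V]]
  have h: "bilinear_map K (self_module K) V ?D (\<lambda>c v. ?\<delta> s (c \<odot>\<^bsub>V\<^esub> v))" if "s \<in> S" for s
    using that by simp
  have b: "bilinear_map K V ?W ?D b"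
    unfolding b_def free_module_def
    by (rule bilinear_map_swap, rule bilinear_map_direct_sum_lift[OF m V D h])
  have be: "b v (?e s) = ?\<delta> s v" if "s \<in> S" "v \<in> carrier V" for s v
    unfolding b_def free_basis_def
    by (subst direct_sum_lift_summand[where M = "\<lambda>_. self_module K" and h = "\<lambda>s c. ?\<delta> s (c \<odot>\<^bsub>V\<^esub> v)",
          OF m D bilinear_mapD(2)[OF h that(2)]])
      (use that in \<open>auto simp: self_module_def\<close>)
  obtain \<theta> where \<theta>: "linear_map K ?T ?D \<theta>"
    and \<theta>t: "\<And>v w. \<lbrakk>v \<in> carrier V; w \<in> carrier ?W\<rbrakk> \<Longrightarrow> \<theta> (?t v w) = b v w"
    using tensor_product_lift[OF V W D b] by blast
  show "bij_betw ?\<sigma> (carrier ?D) (carrier ?T)"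
  proof (rule bij_betw_generators[OF D T lin \<theta> generates_summands[of K S "\<lambda>_. V", OF K V] _ generates_tensor_product[OF V W]])
    show "\<theta> (?\<sigma> x) = x" if "x \<in> (\<Union>s\<in>S. ?\<delta> s ` carrier V)" for x
      using that by (auto simp: \<sigma> \<theta>t be free_basis_closed[OF K])
    show "?\<sigma> (\<theta> x) = x" if x: "x \<in> {?t v w |v w. v \<in> carrier V \<and> w \<in> carrier ?W}" for x
    proof -
      obtain v w where x_eq: "x = ?t v w" and v: "v \<in> carrier V" and w: "w \<in> carrier ?W"
        using x by blast
      \<comment> \<open>The generators of the tensor product allow any \<open>w\<close>. Both sides
        are linear in \<open>w\<close>, so only basis vectors have to be compared, and there
        \<open>be\<close> applies.\<close>
      have "?\<sigma> (b v w) = ?t v w"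
        by (rule linear_map_eq[where f = "\<lambda>w. ?\<sigma> (b v w)" and g = "?t v", OF generates_free[OF K] W T
              linear_map_compose[OF bilinear_mapD(1)[OF b v] lin] bilinear_mapD(1)[OF t v] _ w])
          (use v in \<open>auto simp: be \<sigma>\<close>)
      then show ?thesis
        by (simp add: x_eq v w \<theta>t)
    qed
  qed
qed


section \<open>Isomorphisms of \<open>k\<close>-categories\<close>

lemma (in k_category) comp_closed:
  "\<lbrakk>x \<in> Obj C; y \<in> Obj C; z \<in> Obj C; f \<in> carrier (Hom C x y); g \<in> carrier (Hom C y z)\<rbrakk> \<Longrightarrow>
    Comp C x y z g f \<in> carrier (Hom C x z)"
  using bilinear_mapD(3)[OF comp_bilinear] by blast

lemma (in k_category) isomorphism_ident: "x \<in> Obj C \<Longrightarrow> isomorphism C x x (Ident C x)"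
  by (auto simp: isomorphism_def ident_closed ident_left)

text \<open>Both sides of associativity are linear in each of the three morphisms. For a generator
  \<open>h\<close> they are bilinear in \<open>g\<close> and \<open>f\<close>, which are reduced to
  generators together; linearity in \<open>h\<close> then gives the general case.\<close>

lemma k_category_generatorsI:
  fixes C :: "('k, 'o, 'm) kcat"
  assumes "field K"
    and mod: "\<And>x y. \<lbrakk>x \<in> Obj C; y \<in> Obj C\<rbrakk> \<Longrightarrow> module K (Hom C x y)"
    and bil: "\<And>x y z. \<lbrakk>x \<in> Obj C; y \<in> Obj C; z \<in> Obj C\<rbrakk> \<Longrightarrow>
      bilinear_map K (Hom C y z) (Hom C x y) (Hom C x z) (Comp C x y z)"
    and gen: "\<And>x y. \<lbrakk>x \<in> Obj C; y \<in> Obj C\<rbrakk> \<Longrightarrow> generates K (Hom C x y) (S x y)"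
    and assoc: "\<And>w x y z f g h. \<lbrakk>w \<in> Obj C; x \<in> Obj C; y \<in> Obj C; z \<in> Obj C;
      f \<in> S w x; g \<in> S x y; h \<in> S y z\<rbrakk> \<Longrightarrow>
      Comp C w y z h (Comp C w x y g f) = Comp C w x z (Comp C x y z h g) f"
    and id: "\<And>x. x \<in> Obj C \<Longrightarrow> Ident C x \<in> carrier (Hom C x x)"
    and left: "\<And>x y f. \<lbrakk>x \<in> Obj C; y \<in> Obj C; f \<in> S x y\<rbrakk> \<Longrightarrow> Comp C x y y (Ident C y) f = f"
    and right: "\<And>x y f. \<lbrakk>x \<in> Obj C; y \<in> Obj C; f \<in> S x y\<rbrakk> \<Longrightarrow> Comp C x x y f (Ident C x) = f"
  shows "k_category K C"
proof (rule k_category.intro)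
  fix w x y z f g h
  assume obj: "w \<in> Obj C" "x \<in> Obj C" "y \<in> Obj C" "z \<in> Obj C"
    and f: "f \<in> carrier (Hom C w x)" and g: "g \<in> carrier (Hom C x y)" and h: "h \<in> carrier (Hom C y z)"
  note b = bil[OF obj(1,2,3)] bil[OF obj(1,2,4)] bil[OF obj(1,3,4)] bil[OF obj(2,3,4)]
  have gens: "Comp C w y z h (Comp C w x y g f) = Comp C w x z (Comp C x y z h g) f" if h: "h \<in> S y z" for h
  proof (rule bilinear_map_eq[where h = "\<lambda>g f. Comp C w y z h (Comp C w x y g f)"
        and h' = "\<lambda>g f. Comp C w x z (Comp C x y z h g) f",
        OF gen[OF obj(2,3)] gen[OF obj(1,2)] mod[OF obj(2,3)] mod[OF obj(1,2)] mod[OF obj(1,4)] _ _ _ g f])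
    have hc: "h \<in> carrier (Hom C y z)"
      using h gen[OF obj(3,4)] by (auto simp: generates_def)
    show "bilinear_map K (Hom C x y) (Hom C w x) (Hom C w z) (\<lambda>g f. Comp C w y z h (Comp C w x y g f))"
      by (rule bilinear_map_compose[OF b(1) linear_map_id linear_map_id bilinear_mapD(1)[OF b(3) hc]])
    show "bilinear_map K (Hom C x y) (Hom C w x) (Hom C w z) (\<lambda>g f. Comp C w x z (Comp C x y z h g) f)"
      by (rule bilinear_map_compose[OF b(2) bilinear_mapD(1)[OF b(4) hc] linear_map_id linear_map_id])
  qed (use assoc obj h in blast)
  have gf: "Comp C w x y g f \<in> carrier (Hom C w y)"
    by (rule bilinear_mapD(3)[OF b(1) g f])
  show "Comp C w y z h (Comp C w x y g f) = Comp C w x z (Comp C x y z h g) f"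
    by (rule linear_map_eq[where f = "\<lambda>h. Comp C w y z h (Comp C w x y g f)"
          and g = "\<lambda>h. Comp C w x z (Comp C x y z h g) f",
          OF gen[OF obj(3,4)] mod[OF obj(3,4)] mod[OF obj(1,4)] bilinear_mapD(2)[OF b(3) gf]
          linear_map_compose[OF bilinear_mapD(2)[OF b(4) g] bilinear_mapD(2)[OF b(2) f]] gens h])
next
  fix x y f assume obj: "x \<in> Obj C" "y \<in> Obj C" and f: "f \<in> carrier (Hom C x y)"
  show "Comp C x y y (Ident C y) f = f"
    by (rule linear_map_eq[OF gen[OF obj] mod[OF obj] mod[OF obj]
          bilinear_mapD(1)[OF bil[OF obj obj(2)] id[OF obj(2)]] linear_map_id left[OF obj] f])
  show "Comp C x x y f (Ident C x) = f"
    by (rule linear_map_eq[where f = "\<lambda>f. Comp C x x y f (Ident C x)", OF gen[OF obj] mod[OF obj] mod[OF obj]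
          bilinear_mapD(2)[OF bil[OF obj(1) obj] id[OF obj(1)]] linear_map_id right[OF obj] f])
qed (fact assms)+

text \<open>Of \<open>D\<close>, only modules of morphisms and a bilinear composition are required.
  The functor can thus be constructed before \<open>D\<close> is known to be a category, and the
  axioms of \<open>D\<close> are afterwards deduced from it.\<close>

lemma k_functor_generatorsI:
  assumes C: "k_category K C"
    and mod: "\<And>x y. \<lbrakk>x \<in> Obj D; y \<in> Obj D\<rbrakk> \<Longrightarrow> module K (Hom D x y)"
    and bil: "\<And>x y z. \<lbrakk>x \<in> Obj D; y \<in> Obj D; z \<in> Obj D\<rbrakk> \<Longrightarrow>
      bilinear_map K (Hom D y z) (Hom D x y) (Hom D x z) (Comp D x y z)"
    and gen: "\<And>x y. \<lbrakk>x \<in> Obj C; y \<in> Obj C\<rbrakk> \<Longrightarrow> generates K (Hom C x y) (S x y)"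
    and obj: "\<And>x. x \<in> Obj C \<Longrightarrow> on_obj F x \<in> Obj D"
    and lin: "\<And>x y. \<lbrakk>x \<in> Obj C; y \<in> Obj C\<rbrakk> \<Longrightarrow>
      linear_map K (Hom C x y) (Hom D (on_obj F x) (on_obj F y)) (on_hom F x y)"
    and comp: "\<And>x y z f g. \<lbrakk>x \<in> Obj C; y \<in> Obj C; z \<in> Obj C; f \<in> S x y; g \<in> S y z\<rbrakk> \<Longrightarrow>
      on_hom F x z (Comp C x y z g f) =
      Comp D (on_obj F x) (on_obj F y) (on_obj F z) (on_hom F y z g) (on_hom F x y f)"
    and id: "\<And>x. x \<in> Obj C \<Longrightarrow> on_hom F x x (Ident C x) = Ident D (on_obj F x)"
  shows "k_functor K C D F"
proof -
  interpret C: k_category K C by fact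
  have "on_hom F x z (Comp C x y z g f) =
      Comp D (on_obj F x) (on_obj F y) (on_obj F z) (on_hom F y z g) (on_hom F x y f)"
    if xyz: "x \<in> Obj C" "y \<in> Obj C" "z \<in> Obj C" and f: "f \<in> carrier (Hom C x y)"
      and g: "g \<in> carrier (Hom C y z)" for x y z f g
    by (rule bilinear_map_eq[where h = "\<lambda>g f. on_hom F x z (Comp C x y z g f)"
          and h' = "\<lambda>g f. Comp D (on_obj F x) (on_obj F y) (on_obj F z) (on_hom F y z g) (on_hom F x y f)",
          OF gen[OF xyz(2,3)] gen[OF xyz(1,2)] C.hom_module[OF xyz(2,3)] C.hom_module[OF xyz(1,2)]
          mod[OF obj[OF xyz(1)] obj[OF xyz(3)]]
          bilinear_map_compose[OF C.comp_bilinear[OF xyz] linear_map_id linear_map_id lin[OF xyz(1,3)]]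
          bilinear_map_compose[OF bil[OF obj[OF xyz(1)] obj[OF xyz(2)] obj[OF xyz(3)]]
            lin[OF xyz(2,3)] lin[OF xyz(1,2)] linear_map_id]
          comp[OF xyz] g f])
  with obj lin id show ?thesis
    by (auto simp: k_functor_def)
qed

lemma k_functorD:
  assumes "k_functor K C D F" "x \<in> Obj C"
  shows "on_obj F x \<in> Obj D"
    and "y \<in> Obj C \<Longrightarrow> linear_map K (Hom C x y) (Hom D (on_obj F x) (on_obj F y)) (on_hom F x y)"
    and "\<lbrakk>y \<in> Obj C; z \<in> Obj C; f \<in> carrier (Hom C x y); g \<in> carrier (Hom C y z)\<rbrakk> \<Longrightarrow>
      on_hom F x z (Comp C x y z g f) =
      Comp D (on_obj F x) (on_obj F y) (on_obj F z) (on_hom F y z g) (on_hom F x y f)"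
    and "on_hom F x x (Ident C x) = Ident D (on_obj F x)"
    and "\<lbrakk>y \<in> Obj C; f \<in> carrier (Hom C x y)\<rbrakk> \<Longrightarrow>
      on_hom F x y f \<in> carrier (Hom D (on_obj F x) (on_obj F y))"
  using assms by (auto simp: k_functor_def linear_map_def Pi_iff)

text \<open>Stronger than an equivalence, being bijective on objects. It does not presuppose that
  \<open>D\<close> satisfies the category axioms, so those can be transported along it.\<close>

definition k_isomorphism ::
    "('k, 'r) ring_scheme \<Rightarrow> ('k, 'o, 'm) kcat \<Rightarrow> ('k, 'p, 'n) kcat \<Rightarrow> ('o, 'm, 'p, 'n) kfunctor \<Rightarrow> bool"
  where "k_isomorphism K C D F \<longleftrightarrow>
    k_functor K C D F \<and> bij_betw (on_obj F) (Obj C) (Obj D) \<and>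
    (\<forall>x\<in>Obj C. \<forall>y\<in>Obj C.
      bij_betw (on_hom F x y) (carrier (Hom C x y)) (carrier (Hom D (on_obj F x) (on_obj F y))))"

lemma k_isomorphism_surj:
  assumes "k_isomorphism K C D F"
  shows "Obj D = on_obj F ` Obj C"
    and "\<lbrakk>x \<in> Obj C; y \<in> Obj C\<rbrakk> \<Longrightarrow>
      carrier (Hom D (on_obj F x) (on_obj F y)) = on_hom F x y ` carrier (Hom C x y)"
  using assms by (auto simp: k_isomorphism_def bij_betw_def)

text \<open>Every object and every morphism of \<open>D\<close> is the image of one of
  \<open>C\<close>, and \<open>F\<close> respects composition and identities; each axiom of
  \<open>D\<close> is the image of the same axiom of \<open>C\<close>.\<close>

lemma k_category_transport:
  assumes C: "k_category K C" and F: "k_isomorphism K C D F"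
    and mod: "\<And>x y. \<lbrakk>x \<in> Obj D; y \<in> Obj D\<rbrakk> \<Longrightarrow> module K (Hom D x y)"
    and bil: "\<And>x y z. \<lbrakk>x \<in> Obj D; y \<in> Obj D; z \<in> Obj D\<rbrakk> \<Longrightarrow>
      bilinear_map K (Hom D y z) (Hom D x y) (Hom D x z) (Comp D x y z)"
  shows "k_category K D"
proof -
  interpret C: k_category K C by fact
  have fctr: "k_functor K C D F"
    using F by (simp add: k_isomorphism_def)
  note surj = k_isomorphism_surj[OF F]
  note comp = k_functorD(3)[OF fctr, symmetric] and id = k_functorD(4)[OF fctr, symmetric]
  show ?thesis
  proof (rule k_category.intro)
    fix w x y z f g h
    assume "w \<in> Obj D" "x \<in> Obj D" "y \<in> Obj D" "z \<in> Obj D"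
      and "f \<in> carrier (Hom D w x)" "g \<in> carrier (Hom D x y)" "h \<in> carrier (Hom D y z)"
    then show "Comp D w y z h (Comp D w x y g f) = Comp D w x z (Comp D x y z h g) f"
      by (clarsimp simp: surj comp C.comp_closed C.comp_assoc)
  next
    fix x y f assume "x \<in> Obj D" "y \<in> Obj D" "f \<in> carrier (Hom D x y)"
    then show "Comp D x y y (Ident D y) f = f" and "Comp D x x y f (Ident D x) = f"
      by (clarsimp simp: surj id comp C.ident_closed C.ident_left C.ident_right)+
  next
    fix x assume "x \<in> Obj D"
    then show "Ident D x \<in> carrier (Hom D x x)"
      by (clarsimp simp: surj id C.ident_closed)
  qed (fact C.base_field mod bil)+
qed

lemma k_isomorphism_inverse:
  assumes C: "k_category K C" and D: "k_category K D" and F: "k_isomorphism K C D F"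
  obtains H where "k_isomorphism K D C H"
    and "\<And>x. x \<in> Obj C \<Longrightarrow> on_obj H (on_obj F x) = x"
    and "\<And>x y f. \<lbrakk>x \<in> Obj C; y \<in> Obj C; f \<in> carrier (Hom C x y)\<rbrakk> \<Longrightarrow>
      on_hom H (on_obj F x) (on_obj F y) (on_hom F x y f) = f"
proof -
  interpret C: k_category K C by fact
  interpret D: k_category K D by fact
  have fctr: "k_functor K C D F" and bij: "bij_betw (on_obj F) (Obj C) (Obj D)"
    and hom: "\<And>x y. \<lbrakk>x \<in> Obj C; y \<in> Obj C\<rbrakk> \<Longrightarrow>
      bij_betw (on_hom F x y) (carrier (Hom C x y)) (carrier (Hom D (on_obj F x) (on_obj F y)))"
    using F by (auto simp: k_isomorphism_def)
  note surj = k_isomorphism_surj[OF F]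
  note comp = k_functorD(3)[OF fctr, symmetric] and id = k_functorD(4)[OF fctr, symmetric]
  define q where "q = inv_into (Obj C) (on_obj F)"
  \<comment> \<open>Morphisms are inverted between the preimages \<open>q x\<close> and
    \<open>q y\<close>. By \<open>surj\<close> every object of \<open>D\<close> has the form
    \<open>on_obj F x\<close>, so all properties of \<open>H\<close> are stated at such objects,
    where \<open>q\<close> simplifies away.\<close>
  define H where "H = \<lparr>on_obj = q, on_hom = (\<lambda>x y. inv_into (carrier (Hom C (q x) (q y))) (on_hom F (q x) (q y)))\<rparr>"
  have q: "q (on_obj F x) = x" if "x \<in> Obj C" for x
    unfolding q_def using bij that by (simp add: bij_betw_def)
  have ho: "on_obj H (on_obj F x) = x" if "x \<in> Obj C" for x
    using that by (simp add: H_def q)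
  have hh: "on_hom H (on_obj F x) (on_obj F y) (on_hom F x y f) = f"
    if "x \<in> Obj C" "y \<in> Obj C" "f \<in> carrier (Hom C x y)" for x y f
    using hom[OF that(1,2)] that by (simp add: H_def q bij_betw_def)
  have lin: "linear_map K (Hom D (on_obj F x) (on_obj F y)) (Hom C x y) (on_hom H (on_obj F x) (on_obj F y))"
    and bijH: "bij_betw (on_hom H (on_obj F x) (on_obj F y)) (carrier (Hom D (on_obj F x) (on_obj F y))) (carrier (Hom C x y))"
    if x: "x \<in> Obj C" and y: "y \<in> Obj C" for x y
  proof -
    have "on_hom H (on_obj F x) (on_obj F y) = inv_into (carrier (Hom C x y)) (on_hom F x y)"
      using x y by (simp add: H_def q)
    then show "linear_map K (Hom D (on_obj F x) (on_obj F y)) (Hom C x y) (on_hom H (on_obj F x) (on_obj F y))"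
      and "bij_betw (on_hom H (on_obj F x) (on_obj F y)) (carrier (Hom D (on_obj F x) (on_obj F y))) (carrier (Hom C x y))"
      using linear_map_inv_into[OF C.hom_module[OF x y] D.hom_module k_functorD(2)[OF fctr x y] hom[OF x y]]
        k_functorD(1)[OF fctr] x y bij_betw_inv_into[OF hom[OF x y]] by auto
  qed
  have "k_functor K D C H"
    unfolding k_functor_def surj(1)
    by (auto simp: ho surj(2) comp id hh lin C.comp_closed C.ident_closed)
  moreover have "bij_betw (on_obj H) (Obj D) (Obj C)"
    using bij_betw_inv_into[OF bij] by (simp add: H_def q_def)
  ultimately have "k_isomorphism K D C H"
    unfolding k_isomorphism_def using bijH by (auto simp: surj(1) ho)
  then show ?thesis
    using ho hh by (rule that)
qed

lemma k_isomorphism_compose: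
  assumes F: "k_isomorphism K C D F" and H: "k_isomorphism K D E H"
  shows "k_isomorphism K C E (comp_functor H F)"
proof -
  have f: "k_functor K C D F" and h: "k_functor K D E H"
    using F H by (auto simp: k_isomorphism_def)
  have "k_functor K C E (comp_functor H F)"
    unfolding k_functor_def
    by (auto simp: comp_functor_def k_functorD(1,3,4,5)[OF f] k_functorD(1,3,4,5)[OF h]
        intro!: linear_map_compose[OF k_functorD(2)[OF f] k_functorD(2)[OF h]])
  moreover have "bij_betw (\<lambda>x. on_obj H (on_obj F x)) (Obj C) (Obj E)"
    using bij_betw_trans[of "on_obj F" "Obj C" "Obj D" "on_obj H" "Obj E"] F H
    by (simp add: k_isomorphism_def comp_def)
  moreover have "bij_betw (\<lambda>f. on_hom H (on_obj F x) (on_obj F y) (on_hom F x y f)) (carrier (Hom C x y))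
      (carrier (Hom E (on_obj H (on_obj F x)) (on_obj H (on_obj F y))))"
    if "x \<in> Obj C" "y \<in> Obj C" for x y
  proof -
    have "bij_betw (on_hom F x y) (carrier (Hom C x y)) (carrier (Hom D (on_obj F x) (on_obj F y)))"
      using F that by (simp add: k_isomorphism_def)
    moreover have "bij_betw (on_hom H (on_obj F x) (on_obj F y)) (carrier (Hom D (on_obj F x) (on_obj F y)))
        (carrier (Hom E (on_obj H (on_obj F x)) (on_obj H (on_obj F y))))"
      using H k_functorD(1)[OF f] that by (simp add: k_isomorphism_def)
    ultimately show ?thesis
      using bij_betw_trans by (fastforce simp: comp_def)
  qed
  ultimately show ?thesis
    by (simp add: k_isomorphism_def comp_functor_def)
qed

text \<open>Functors that agree on actual objects and morphisms may still differ as records.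
  Identity morphisms then serve as the components of a natural isomorphism.\<close>

lemma naturally_isomorphic_identI:
  assumes D: "k_category K D"
    and obj: "\<And>x. x \<in> Obj C \<Longrightarrow> on_obj F x \<in> Obj D \<and> on_obj F' x = on_obj F x"
    and hom: "\<And>x y f. \<lbrakk>x \<in> Obj C; y \<in> Obj C; f \<in> carrier (Hom C x y)\<rbrakk> \<Longrightarrow>
      on_hom F x y f \<in> carrier (Hom D (on_obj F x) (on_obj F y)) \<and> on_hom F' x y f = on_hom F x y f"
  shows "naturally_isomorphic C D F F'"
proof -
  interpret D: k_category K D by fact
  show ?thesis
    unfolding naturally_isomorphic_def
    by (rule exI[of _ "\<lambda>x. Ident D (on_obj F x)"])
      (use obj hom in \<open>auto simp: D.isomorphism_ident D.ident_left D.ident_right\<close>)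
qed

lemma k_isomorphism_imp_equivalent:
  assumes C: "k_category K C" and D: "k_category K D" and F: "k_isomorphism K C D F"
  shows "k_equivalent K C D"
proof -
  obtain H where H: "k_isomorphism K D C H"
    and ho: "\<And>x. x \<in> Obj C \<Longrightarrow> on_obj H (on_obj F x) = x"
    and hh: "\<And>x y f. \<lbrakk>x \<in> Obj C; y \<in> Obj C; f \<in> carrier (Hom C x y)\<rbrakk> \<Longrightarrow>
      on_hom H (on_obj F x) (on_obj F y) (on_hom F x y f) = f"
    using k_isomorphism_inverse[OF C D F] by blast
  have fctr: "k_functor K C D F" and "k_functor K D C H"
    using F H by (auto simp: k_isomorphism_def)
  moreover have "naturally_isomorphic C C (comp_functor H F) id_functor"
    by (rule naturally_isomorphic_identI[OF C]) (auto simp: comp_functor_def id_functor_def ho hh)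
  moreover have "naturally_isomorphic D D (comp_functor F H) id_functor"
    by (rule naturally_isomorphic_identI[OF D])
      (auto simp: comp_functor_def id_functor_def k_isomorphism_surj[OF F] ho hh)
  ultimately show ?thesis
    using C D by (auto simp: k_equivalent_def)
qed


section \<open>The category of graded morphisms\<close>

definition graded_hom :: "('g, 's) monoid_scheme \<Rightarrow> ('k, 'o, 'm) kcat \<Rightarrow> 'o \<Rightarrow> 'o \<Rightarrow> ('k, 'g \<Rightarrow> 'm) module"
  where "graded_hom G C x y = direct_sum (carrier G) (\<lambda>_. Hom C x y)"

definition homogeneous ::
    "('g, 's) monoid_scheme \<Rightarrow> ('k, 'o, 'm) kcat \<Rightarrow> 'o \<Rightarrow> 'o \<Rightarrow> 'g \<Rightarrow> 'm \<Rightarrow> 'g \<Rightarrow> 'm"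
  where "homogeneous G C x y = summand (carrier G) (\<lambda>_. Hom C x y)"

text \<open>The smash category in coordinates; for a single object it is the skew group algebra. The
  shape of the definition copies that of \<open>smash_category\<close>, with a direct sum in place
  of the tensor product.\<close>

definition graded_category ::
    "('k, 'r) ring_scheme \<Rightarrow> ('g, 's) monoid_scheme \<Rightarrow> ('k, 'o, 'm) kcat \<Rightarrow>
     ('g \<Rightarrow> 'o \<Rightarrow> 'o \<Rightarrow> 'm \<Rightarrow> 'm) \<Rightarrow> ('k, 'o, 'g \<Rightarrow> 'm) kcat"
  where "graded_category K G C act =
    \<lparr>Obj = Obj C,
     Hom = graded_hom G C,
     Comp = (\<lambda>x y z. SOME \<mu>.
       bilinear_map K (graded_hom G C y z) (graded_hom G C x y) (graded_hom G C x z) \<mu> \<and>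
       (\<forall>g\<in>carrier (Hom C y z). \<forall>f\<in>carrier (Hom C x y). \<forall>v\<in>carrier G. \<forall>u\<in>carrier G.
         \<mu> (homogeneous G C y z v g) (homogeneous G C x y u f) =
         homogeneous G C x z (v \<otimes>\<^bsub>G\<^esub> u) (Comp C x y z g (act v x y f)))),
     Ident = (\<lambda>x. homogeneous G C x x \<one>\<^bsub>G\<^esub> (Ident C x))\<rparr>"

text \<open>Used with a composition for \<open>x\<close>: one witness \<open>a\<close> of the
  property that defines it yields the property for the composition itself.\<close>

lemma eq_Eps_imp: "\<lbrakk>x = Eps P; P a\<rbrakk> \<Longrightarrow> P x"
  by (simp add: someI)

context kG_module_category
begin

abbreviation "graded \<equiv> graded_category K G C act"

lemma cring_base: "cring K"
  using base_field by (simp add: field_def domain_def)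

lemma act_closed:
  "\<lbrakk>s \<in> carrier G; x \<in> Obj C; y \<in> Obj C; f \<in> carrier (Hom C x y)\<rbrakk> \<Longrightarrow> act s x y f \<in> carrier (Hom C x y)"
  using linear_map_closed[OF act_linear] .

lemma module_graded_hom: "\<lbrakk>x \<in> Obj C; y \<in> Obj C\<rbrakk> \<Longrightarrow> module K (graded_hom G C x y)"
  unfolding graded_hom_def by (intro module_direct_sum cring_base hom_module)

lemma linear_map_homogeneous:
  "\<lbrakk>x \<in> Obj C; y \<in> Obj C; u \<in> carrier G\<rbrakk> \<Longrightarrow>
    linear_map K (Hom C x y) (graded_hom G C x y) (homogeneous G C x y u)"
  unfolding graded_hom_def homogeneous_def
  by (rule linear_map_summand[where M = "\<lambda>_. Hom C x y"]) (auto intro: hom_module)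

lemma homogeneous_closed:
  "\<lbrakk>x \<in> Obj C; y \<in> Obj C; u \<in> carrier G; f \<in> carrier (Hom C x y)\<rbrakk> \<Longrightarrow>
    homogeneous G C x y u f \<in> carrier (graded_hom G C x y)"
  by (rule linear_map_closed[OF linear_map_homogeneous])

lemma generates_homogeneous:
  "\<lbrakk>x \<in> Obj C; y \<in> Obj C\<rbrakk> \<Longrightarrow>
    generates K (graded_hom G C x y) (\<Union>u\<in>carrier G. homogeneous G C x y u ` carrier (Hom C x y))"
  unfolding graded_hom_def homogeneous_def
  by (rule generates_summands[where M = "\<lambda>_. Hom C x y"]) (auto intro: hom_module cring_base)

text \<open>The witness for the \<open>SOME\<close> is glued from one map for each pair of degrees
  \<open>v\<close>, \<open>u\<close>; each is bilinear because \<open>act v\<close> is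
  linear.\<close>

lemma graded_comp:
  assumes x: "x \<in> Obj C" and y: "y \<in> Obj C" and z: "z \<in> Obj C"
  shows graded_comp_bilinear:
      "bilinear_map K (graded_hom G C y z) (graded_hom G C x y) (graded_hom G C x z) (Comp graded x y z)"
    and graded_comp_homogeneous:
      "\<lbrakk>g \<in> carrier (Hom C y z); f \<in> carrier (Hom C x y); v \<in> carrier G; u \<in> carrier G\<rbrakk> \<Longrightarrow>
        Comp graded x y z (homogeneous G C y z v g) (homogeneous G C x y u f) =
        homogeneous G C x z (v \<otimes>\<^bsub>G\<^esub> u) (Comp C x y z g (act v x y f))"
proof -
  let ?P = "\<lambda>\<mu>. bilinear_map K (graded_hom G C y z) (graded_hom G C x y) (graded_hom G C x z) \<mu> \<and>
       (\<forall>g\<in>carrier (Hom C y z). \<forall>f\<in>carrier (Hom C x y). \<forall>v\<in>carrier G. \<forall>u\<in>carrier G.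
         \<mu> (homogeneous G C y z v g) (homogeneous G C x y u f) =
         homogeneous G C x z (v \<otimes>\<^bsub>G\<^esub> u) (Comp C x y z g (act v x y f)))"
  have h: "bilinear_map K (Hom C y z) (Hom C x y) (graded_hom G C x z)
      (\<lambda>g f. homogeneous G C x z (v \<otimes>\<^bsub>G\<^esub> u) (Comp C x y z g (act v x y f)))"
    if "v \<in> carrier G" "u \<in> carrier G" for v u
    by (rule bilinear_map_compose[OF comp_bilinear[OF x y z] linear_map_id act_linear[OF that(1) x y]
          linear_map_homogeneous[OF x z m_closed[OF that]]])
  obtain \<mu> where "?P \<mu>"
    using direct_sum_bilinear_extension[of "carrier G" K "\<lambda>_. Hom C y z" "carrier G" "\<lambda>_. Hom C x y"
        "graded_hom G C x z" "\<lambda>v u g f. homogeneous G C x z (v \<otimes>\<^bsub>G\<^esub> u) (Comp C x y z g (act v x y f))",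
        OF hom_module[OF y z] hom_module[OF x y] module_graded_hom[OF x z] h]
    unfolding graded_hom_def homogeneous_def by metis
  then have "?P (Comp graded x y z)"
    by (rule eq_Eps_imp[where P = ?P, rotated]) (simp add: graded_category_def)
  then show "bilinear_map K (graded_hom G C y z) (graded_hom G C x y) (graded_hom G C x z) (Comp graded x y z)"
    and "\<lbrakk>g \<in> carrier (Hom C y z); f \<in> carrier (Hom C x y); v \<in> carrier G; u \<in> carrier G\<rbrakk> \<Longrightarrow>
        Comp graded x y z (homogeneous G C y z v g) (homogeneous G C x y u f) =
        homogeneous G C x z (v \<otimes>\<^bsub>G\<^esub> u) (Comp C x y z g (act v x y f))"
    by blast+
qed

lemma graded_simps [simp]:
  "Obj graded = Obj C" "Hom graded = graded_hom G C"
  "Ident graded x = homogeneous G C x x \<one>\<^bsub>G\<^esub> (Ident C x)"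
  by (simp_all add: graded_category_def)

text \<open>For homogeneous morphisms with \<open>g\<close> in degree \<open>v\<close> and
  \<open>h\<close> in degree \<open>r\<close>, associativity amounts to
  \<open>h (r (g (v f))) = (h (r g)) ((r v) f)\<close>, that is, to \<open>act_comp\<close>,
  \<open>act_mult\<close> and associativity in \<open>C\<close>. The left identity law uses
  \<open>act_one\<close>, the right one \<open>act_ident\<close>.\<close>

lemma k_category_graded: "k_category K graded"
  by (rule k_category_generatorsI[where S = "\<lambda>x y. \<Union>u\<in>carrier G. homogeneous G C x y u ` carrier (Hom C x y)"])
    (auto simp: base_field module_graded_hom graded_comp_bilinear generates_homogeneous
      graded_comp_homogeneous homogeneous_closed ident_closed act_closed comp_closed
      act_comp act_mult act_one act_ident ident_left ident_right comp_assoc m_assoc)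

text \<open>The common criterion for the smash category and the quotient. Compatibility is tested on
  homogeneous morphisms, and associativity and the identity laws of \<open>E\<close> are part of the
  conclusion: they are transported from the graded category.\<close>

lemma graded_isomorphismI:
  assumes obj: "bij_betw (on_obj F) (Obj C) (Obj E)"
    and mod: "\<And>\<alpha> \<beta>. \<lbrakk>\<alpha> \<in> Obj E; \<beta> \<in> Obj E\<rbrakk> \<Longrightarrow> module K (Hom E \<alpha> \<beta>)"
    and bil: "\<And>\<alpha> \<beta> \<gamma>. \<lbrakk>\<alpha> \<in> Obj E; \<beta> \<in> Obj E; \<gamma> \<in> Obj E\<rbrakk> \<Longrightarrow>
      bilinear_map K (Hom E \<beta> \<gamma>) (Hom E \<alpha> \<beta>) (Hom E \<alpha> \<gamma>) (Comp E \<alpha> \<beta> \<gamma>)"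
    and lin: "\<And>x y. \<lbrakk>x \<in> Obj C; y \<in> Obj C\<rbrakk> \<Longrightarrow>
      linear_map K (graded_hom G C x y) (Hom E (on_obj F x) (on_obj F y)) (on_hom F x y)"
    and bij: "\<And>x y. \<lbrakk>x \<in> Obj C; y \<in> Obj C\<rbrakk> \<Longrightarrow>
      bij_betw (on_hom F x y) (carrier (graded_hom G C x y)) (carrier (Hom E (on_obj F x) (on_obj F y)))"
    and comp: "\<And>x y z f g u v. \<lbrakk>x \<in> Obj C; y \<in> Obj C; z \<in> Obj C; f \<in> carrier (Hom C x y);
      g \<in> carrier (Hom C y z); u \<in> carrier G; v \<in> carrier G\<rbrakk> \<Longrightarrow>
      Comp E (on_obj F x) (on_obj F y) (on_obj F z)
        (on_hom F y z (homogeneous G C y z v g)) (on_hom F x y (homogeneous G C x y u f)) =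
      on_hom F x z (homogeneous G C x z (v \<otimes>\<^bsub>G\<^esub> u) (Comp C x y z g (act v x y f)))"
    and id: "\<And>x. x \<in> Obj C \<Longrightarrow>
      on_hom F x x (homogeneous G C x x \<one>\<^bsub>G\<^esub> (Ident C x)) = Ident E (on_obj F x)"
  shows "k_category K E" and "k_isomorphism K graded E F"
proof -
  have "k_functor K graded E F"
    by (rule k_functor_generatorsI[OF k_category_graded mod bil,
          where S = "\<lambda>x y. \<Union>u\<in>carrier G. homogeneous G C x y u ` carrier (Hom C x y)"])
      (use bij_betwE[OF obj] in \<open>auto simp: generates_homogeneous lin id comp graded_comp_homogeneous\<close>)
  then show iso: "k_isomorphism K graded E F"
    by (simp add: k_isomorphism_def obj bij)
  show "k_category K E"
    by (rule k_category_transport[OF k_category_graded iso mod bil])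
qed


section \<open>The smash category\<close>

lemma module_group_space: "module K (group_space K G)"
  unfolding group_space_def by (rule module_free[OF cring_base])

lemma module_smash_hom: "\<lbrakk>x \<in> Obj C; y \<in> Obj C\<rbrakk> \<Longrightarrow> module K (smash_hom K G C x y)"
  unfolding smash_hom_def by (rule module_tensor_product[OF hom_module module_group_space])

definition graded_to_smash :: "('o, 'g \<Rightarrow> 'm, 'o, ('m \<times> ('g \<Rightarrow> 'k) \<Rightarrow> 'k) set) kfunctor"
  where "graded_to_smash = \<lparr>on_obj = (\<lambda>x. x), on_hom = (\<lambda>x y. tensor_free_map K (Hom C x y) (carrier G))\<rparr>"

lemma graded_to_smash_hom:
  assumes "x \<in> Obj C" "y \<in> Obj C"
  shows "linear_map K (graded_hom G C x y) (smash_hom K G C x y) (on_hom graded_to_smash x y)"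
    and "bij_betw (on_hom graded_to_smash x y) (carrier (graded_hom G C x y)) (carrier (smash_hom K G C x y))"
    and "\<lbrakk>u \<in> carrier G; f \<in> carrier (Hom C x y)\<rbrakk> \<Longrightarrow>
      on_hom graded_to_smash x y (homogeneous G C x y u f) = smash_tensor K G C x y f u"
  unfolding graded_hom_def smash_hom_def homogeneous_def smash_tensor_def graded_to_smash_def
    group_space_def group_elem_def
  using tensor_free_map[OF hom_module[OF assms], where S = "carrier G"] by simp_all

text \<open>Transporting the graded composition replaces a direct construction, which would have to
  respect the tensor relations in both arguments. On homogeneous morphisms the transported map has
  the values required by the \<open>SOME\<close>.\<close>

lemma smash_comp:
  assumes x: "x \<in> Obj C" and y: "y \<in> Obj C" and z: "z \<in> Obj C"
  shows "bilinear_map K (smash_hom K G C y z) (smash_hom K G C x y) (smash_hom K G C x z)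
      (Comp (smash_category K G C act) x y z)" (is ?bil)
    and "\<lbrakk>g \<in> carrier (Hom C y z); f \<in> carrier (Hom C x y); v \<in> carrier G; u \<in> carrier G\<rbrakk> \<Longrightarrow>
        Comp (smash_category K G C act) x y z (smash_tensor K G C y z g v) (smash_tensor K G C x y f u) =
        smash_tensor K G C x z (Comp C x y z g (act v x y f)) (v \<otimes>\<^bsub>G\<^esub> u)" (is "PROP ?val")
proof -
  let ?P = "\<lambda>\<mu>. bilinear_map K (smash_hom K G C y z) (smash_hom K G C x y) (smash_hom K G C x z) \<mu> \<and>
       (\<forall>g\<in>carrier (Hom C y z). \<forall>f\<in>carrier (Hom C x y). \<forall>v\<in>carrier G. \<forall>u\<in>carrier G.
         \<mu> (smash_tensor K G C y z g v) (smash_tensor K G C x y f u) =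
         smash_tensor K G C x z (Comp C x y z g (act v x y f)) (v \<otimes>\<^bsub>G\<^esub> u))"
  obtain \<mu> where \<mu>: "bilinear_map K (smash_hom K G C y z) (smash_hom K G C x y) (smash_hom K G C x z) \<mu>"
    and val: "\<And>\<Psi> \<Phi>. \<lbrakk>\<Psi> \<in> carrier (graded_hom G C y z); \<Phi> \<in> carrier (graded_hom G C x y)\<rbrakk> \<Longrightarrow>
      \<mu> (on_hom graded_to_smash y z \<Psi>) (on_hom graded_to_smash x y \<Phi>) =
      on_hom graded_to_smash x z (Comp graded x y z \<Psi> \<Phi>)"
    by (rule bilinear_map_transport[OF module_graded_hom[OF y z] module_smash_hom[OF y z]
        graded_to_smash_hom(1,2)[OF y z] module_graded_hom[OF x y] module_smash_hom[OF x y]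
        graded_to_smash_hom(1,2)[OF x y] graded_to_smash_hom(1)[OF x z] graded_comp_bilinear[OF x y z]]) blast
  have "\<mu> (smash_tensor K G C y z g v) (smash_tensor K G C x y f u) =
      smash_tensor K G C x z (Comp C x y z g (act v x y f)) (v \<otimes>\<^bsub>G\<^esub> u)"
    if "g \<in> carrier (Hom C y z)" "f \<in> carrier (Hom C x y)" "v \<in> carrier G" "u \<in> carrier G" for g f v u
    using val[of "homogeneous G C y z v g" "homogeneous G C x y u f"] that x y z
    by (simp add: homogeneous_closed graded_to_smash_hom graded_comp_homogeneous comp_closed act_closed)
  with \<mu> have "?P \<mu>" by blast
  then have "?P (Comp (smash_category K G C act) x y z)"
    by (rule eq_Eps_imp[where P = ?P, rotated]) (simp add: smash_category_def)
  then show ?bil and "PROP ?val"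
    by blast+
qed

lemma smash_isomorphism:
  shows k_category_smash: "k_category K (smash_category K G C act)"
    and graded_to_smash_isomorphism: "k_isomorphism K graded (smash_category K G C act) graded_to_smash"
proof -
  have [simp]: "on_obj graded_to_smash = (\<lambda>x. x)" "Obj (smash_category K G C act) = Obj C"
    "Hom (smash_category K G C act) = smash_hom K G C"
    "Ident (smash_category K G C act) x = smash_tensor K G C x x (Ident C x) \<one>\<^bsub>G\<^esub>" for x
    by (simp_all add: graded_to_smash_def smash_category_def)
  show "k_category K (smash_category K G C act)"
    and "k_isomorphism K graded (smash_category K G C act) graded_to_smash"
    by (rule graded_isomorphismI[of graded_to_smash];
        simp add: bij_betw_id[unfolded id_def] module_smash_hom smash_comp graded_to_smash_hom ident_closed comp_closed act_closed)+
qed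


section \<open>The quotient of the inflated category\<close>

text \<open>This is the orbit of each \<open>(x, s)\<close>, by \<open>orbit_inflated\<close>.
  Naming it by \<open>x\<close> alone makes the objects of the quotient correspond to those of
  \<open>C\<close>.\<close>

definition fibre :: "'o \<Rightarrow> ('o \<times> 'g) set"
  where "fibre x = {x} \<times> carrier G"

definition fibre_sum :: "'o \<Rightarrow> 'o \<Rightarrow> ('k, ('o \<times> 'g) \<times> ('o \<times> 'g) \<Rightarrow> 'm) module"
  where "fibre_sum x y = orbit_sum (inflated_category G C) (fibre x) (fibre y)"

definition fibre_summand :: "'o \<Rightarrow> 'o \<Rightarrow> 'g \<Rightarrow> 'g \<Rightarrow> 'm \<Rightarrow> ('o \<times> 'g) \<times> ('o \<times> 'g) \<Rightarrow> 'm"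
  where "fibre_summand x y s t =
    summand (fibre y \<times> fibre x) (\<lambda>(b, a). Hom (inflated_category G C) a b) ((y, t), (x, s))"

definition fibre_act ::
    "'o \<Rightarrow> 'o \<Rightarrow> 'g \<Rightarrow> (('o \<times> 'g) \<times> ('o \<times> 'g) \<Rightarrow> 'm) \<Rightarrow> ('o \<times> 'g) \<times> ('o \<times> 'g) \<Rightarrow> 'm"
  where "fibre_act x y = orbit_sum_act G (inflated_action G C act) (fibre x) (fibre y)"

abbreviation fibre_hom :: "'o \<Rightarrow> 'o \<Rightarrow> ('k, (('o \<times> 'g) \<times> ('o \<times> 'g) \<Rightarrow> 'm) set) module"
  where "fibre_hom x y \<equiv>
    quotient_hom K G (inflated_category G C) (inflated_action G C act) (fibre x) (fibre y)"

abbreviation fibre_class :: "'o \<Rightarrow> 'o \<Rightarrow> 'g \<Rightarrow> 'g \<Rightarrow> 'm \<Rightarrow> (('o \<times> 'g) \<times> ('o \<times> 'g) \<Rightarrow> 'm) set"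
  where "fibre_class x y s t \<equiv>
    quotient_class K G (inflated_category G C) (inflated_action G C act) (fibre x) (fibre y) (x, s) (y, t)"

lemma inflated_simps [simp]:
  "Hom (inflated_category G C) (x, s) (y, t) = Hom C x y"
  "Comp (inflated_category G C) (x, s) (y, t) (z, r) = Comp C x y z"
  "Ident (inflated_category G C) (x, s) = Ident C x"
  "Obj (inflated_category G C) = Obj C \<times> carrier G"
  "act_hom (inflated_action G C act) u (x, s) (y, t) = act u x y"
  "\<lbrakk>x \<in> Obj C; s \<in> carrier G\<rbrakk> \<Longrightarrow> act_obj (inflated_action G C act) u (x, s) = (x, u \<otimes>\<^bsub>G\<^esub> s)"
  by (simp_all add: inflated_category_def inflated_action_def)

lemma orbit_inflated:
  assumes "x \<in> Obj C" "s \<in> carrier G"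
  shows "orbit G (act_obj (inflated_action G C act)) (x, s) = fibre x"
proof -
  have "\<exists>u\<in>carrier G. t = u \<otimes>\<^bsub>G\<^esub> s" if "t \<in> carrier G" for t
    using that assms by (intro bexI[of _ "t \<otimes>\<^bsub>G\<^esub> inv\<^bsub>G\<^esub> s"]) (auto simp: m_assoc)
  with assms show ?thesis
    by (auto simp: orbit_def fibre_def)
qed

lemma orbits_inflated:
  "orbits G (Obj (inflated_category G C)) (act_obj (inflated_action G C act)) = fibre ` Obj C"
  using orbit_inflated by (fastforce simp: orbits_def)

section \<open>Sums of morphism spaces and coinvariants between two fibres\<close>

context
  fixes x y :: 'o
  assumes x: "x \<in> Obj C" and y: "y \<in> Obj C"
begin

lemma module_fibre_components:
  "i \<in> fibre y \<times> fibre x \<Longrightarrow> module K (case i of (b, a) \<Rightarrow> Hom (inflated_category G C) a b)"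
  using hom_module[OF x y] by (auto simp: fibre_def)

lemma module_fibre_sum: "module K (fibre_sum x y)"
  unfolding fibre_sum_def orbit_sum_def by (rule module_direct_sum[OF cring_base module_fibre_components])

lemma linear_map_fibre_summand:
  assumes "s \<in> carrier G" "t \<in> carrier G"
  shows "linear_map K (Hom C x y) (fibre_sum x y) (fibre_summand x y s t)"
  using linear_map_summand[where i = "((y, t), (x, s))" and M = "\<lambda>(b, a). Hom (inflated_category G C) a b",
      OF module_fibre_components] assms
  unfolding fibre_sum_def orbit_sum_def fibre_summand_def by (simp add: fibre_def)

lemma generates_fibre_sum:
  "generates K (fibre_sum x y) {fibre_summand x y s t f |s t f. s \<in> carrier G \<and> t \<in> carrier G \<and> f \<in> carrier (Hom C x y)}"
proof -
  have "(\<Union>i\<in>fibre y \<times> fibre x. summand (fibre y \<times> fibre x) (\<lambda>(b, a). Hom (inflated_category G C) a b) i `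
        carrier (case i of (b, a) \<Rightarrow> Hom (inflated_category G C) a b)) =
      {fibre_summand x y s t f |s t f. s \<in> carrier G \<and> t \<in> carrier G \<and> f \<in> carrier (Hom C x y)}"
    by (force simp: fibre_def fibre_summand_def)
  then show ?thesis
    using generates_summands[where M = "\<lambda>(b, a). Hom (inflated_category G C) a b" and I = "fibre y \<times> fibre x",
        OF cring_base module_fibre_components]
    unfolding fibre_sum_def orbit_sum_def by simp
qed

lemma fibre_act_app:
  assumes "u \<in> carrier G" "s \<in> carrier G" "t \<in> carrier G"
  shows "fibre_act x y u \<Phi> ((y, t), (x, s)) =
    act u x y (\<Phi> ((y, inv\<^bsub>G\<^esub> u \<otimes>\<^bsub>G\<^esub> t), (x, inv\<^bsub>G\<^esub> u \<otimes>\<^bsub>G\<^esub> s)))"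
  using assms x y by (simp add: fibre_act_def orbit_sum_act_def fibre_def Let_def)

lemma fibre_sum_app:
  assumes "s \<in> carrier G" "t \<in> carrier G"
  shows "\<Phi> \<in> carrier (fibre_sum x y) \<Longrightarrow> \<Phi> ((y, t), (x, s)) \<in> carrier (Hom C x y)"
    and "(\<Phi> \<oplus>\<^bsub>fibre_sum x y\<^esub> \<Psi>) ((y, t), (x, s)) = \<Phi> ((y, t), (x, s)) \<oplus>\<^bsub>Hom C x y\<^esub> \<Psi> ((y, t), (x, s))"
    and "(c \<odot>\<^bsub>fibre_sum x y\<^esub> \<Phi>) ((y, t), (x, s)) = c \<odot>\<^bsub>Hom C x y\<^esub> \<Phi> ((y, t), (x, s))"
  using direct_sum_app[where i = "((y, t), (x, s))" and I = "fibre y \<times> fibre x"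
      and M = "\<lambda>(b, a). Hom (inflated_category G C) a b"] assms
  by (auto simp: fibre_sum_def orbit_sum_def fibre_def)

lemma fibre_sum_eqI:
  assumes "\<Phi> \<in> carrier (fibre_sum x y)" "\<Psi> \<in> carrier (fibre_sum x y)"
    and "\<And>s t. \<lbrakk>s \<in> carrier G; t \<in> carrier G\<rbrakk> \<Longrightarrow> \<Phi> ((y, t), (x, s)) = \<Psi> ((y, t), (x, s))"
  shows "\<Phi> = \<Psi>"
  using assms unfolding fibre_sum_def orbit_sum_def
  by (intro direct_sum_eqI[of \<Phi> "fibre y \<times> fibre x" _ \<Psi>]) (auto simp: fibre_def)

text \<open>The point to check is finite support: the image of \<open>\<Phi>\<close> under
  \<open>u\<close> is supported in the translate by \<open>u\<close>, written \<open>?m\<close>, of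
  the support of \<open>\<Phi>\<close>.\<close>

lemma linear_map_fibre_act:
  assumes u: "u \<in> carrier G"
  shows "linear_map K (fibre_sum x y) (fibre_sum x y) (fibre_act x y u)"
proof -
  interpret X: module K "fibre_sum x y" by (rule module_fibre_sum)
  let ?M = "\<lambda>(b, a). Hom (inflated_category G C) a b"
  have closed: "fibre_act x y u \<Phi> \<in> carrier (fibre_sum x y)" if \<Phi>: "\<Phi> \<in> carrier (fibre_sum x y)" for \<Phi>
  proof -
    let ?S = "{i \<in> fibre y \<times> fibre x. \<Phi> i \<noteq> \<zero>\<^bsub>?M i\<^esub>}"
    let ?m = "\<lambda>((y, t), (x, s)). ((y, u \<otimes>\<^bsub>G\<^esub> t), (x, u \<otimes>\<^bsub>G\<^esub> s))"
    have fin: "finite ?S"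
      using \<Phi> unfolding fibre_sum_def orbit_sum_def by (rule direct_sum_support)
    have zero: "fibre_act x y u \<Phi> ((y, t), (x, s)) = \<zero>\<^bsub>Hom C x y\<^esub>"
      if st: "s \<in> carrier G" "t \<in> carrier G" and "((y, t), (x, s)) \<notin> ?m ` ?S" for s t
    proof -
      let ?i = "((y, inv\<^bsub>G\<^esub> u \<otimes>\<^bsub>G\<^esub> t), (x, inv\<^bsub>G\<^esub> u \<otimes>\<^bsub>G\<^esub> s))"
      have "?m ?i = ((y, t), (x, s))"
        using st u by (simp add: m_assoc[symmetric])
      then have "?i \<notin> ?S"
        using that(3) rev_image_eqI[of ?i ?S _ ?m] by auto
      then have "\<Phi> ?i = \<zero>\<^bsub>Hom C x y\<^esub>"
        using st u by (simp add: fibre_def)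
      then show ?thesis
        using st u linear_map_zero[OF hom_module[OF x y] hom_module[OF x y] act_linear[OF u x y]]
        by (simp add: fibre_act_app)
    qed
    have "(\<lambda>i\<in>fibre y \<times> fibre x. fibre_act x y u \<Phi> i) \<in> carrier (direct_sum (fibre y \<times> fibre x) ?M)"
    proof (rule direct_sum_restrictI[OF _ finite_imageI[OF fin, of ?m]])
      show "fibre_act x y u \<Phi> i \<in> carrier (?M i)" if "i \<in> fibre y \<times> fibre x" for i
        using that u \<Phi> x y by (auto simp: fibre_def fibre_act_app act_closed fibre_sum_app(1))
      show "fibre_act x y u \<Phi> i = \<zero>\<^bsub>?M i\<^esub>" if "i \<in> fibre y \<times> fibre x" "i \<notin> ?m ` ?S" for i
        using that zero by (auto simp: fibre_def)
    qed
    moreover have "(\<lambda>i\<in>fibre y \<times> fibre x. fibre_act x y u \<Phi> i) = fibre_act x y u \<Phi>"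
      by (auto simp: fibre_act_def orbit_sum_act_def)
    ultimately show ?thesis
      by (simp add: fibre_sum_def orbit_sum_def)
  qed
  note act = linear_map_add[OF act_linear[OF u x y]] linear_map_smult[OF act_linear[OF u x y]]
  show ?thesis
    by (rule linear_mapI)
      (auto intro!: closed fibre_sum_eqI simp: fibre_act_app fibre_sum_app act u)
qed

lemma fibre_act_summand:
  assumes u: "u \<in> carrier G" and s: "s \<in> carrier G" and t: "t \<in> carrier G" and f: "f \<in> carrier (Hom C x y)"
  shows "fibre_act x y u (fibre_summand x y s t f) =
    fibre_summand x y (u \<otimes>\<^bsub>G\<^esub> s) (u \<otimes>\<^bsub>G\<^esub> t) (act u x y f)"
proof (rule fibre_sum_eqI)
  show "fibre_act x y u (fibre_summand x y s t f) \<in> carrier (fibre_sum x y)"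
    by (rule linear_map_closed[OF linear_map_fibre_act[OF u] linear_map_closed[OF linear_map_fibre_summand[OF s t] f]])
  show "fibre_summand x y (u \<otimes>\<^bsub>G\<^esub> s) (u \<otimes>\<^bsub>G\<^esub> t) (act u x y f) \<in> carrier (fibre_sum x y)"
    by (rule linear_map_closed[OF linear_map_fibre_summand]) (use assms x y in \<open>auto intro: act_closed\<close>)
  fix s' t' assume st': "s' \<in> carrier G" "t' \<in> carrier G"
  \<comment> \<open>Both sides of the goal are concentrated in one component. The left one tests the
    translates of \<open>s'\<close> and \<open>t'\<close> by the inverse of \<open>u\<close>, the
    right one compares with the translates of \<open>s\<close> and \<open>t\<close> by
    \<open>u\<close>.\<close>
  have inv_eq: "inv\<^bsub>G\<^esub> u \<otimes>\<^bsub>G\<^esub> r' = r \<longleftrightarrow> r' = u \<otimes>\<^bsub>G\<^esub> r" if "r \<in> carrier G" "r' \<in> carrier G" for r r'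
    using that u inv_solve_left[of r u r'] by auto
  show "fibre_act x y u (fibre_summand x y s t f) ((y, t'), (x, s')) =
      fibre_summand x y (u \<otimes>\<^bsub>G\<^esub> s) (u \<otimes>\<^bsub>G\<^esub> t) (act u x y f) ((y, t'), (x, s'))"
    using assms st' linear_map_zero[OF hom_module[OF x y] hom_module[OF x y] act_linear[OF u x y]]
    by (auto simp: fibre_act_app fibre_summand_def summand_def fibre_def inv_eq)
qed

lemma fibre_relations_closed:
  "coinvariant_relations G (fibre_sum x y) (fibre_act x y) \<subseteq> carrier (fibre_sum x y)"
proof -
  interpret X: module K "fibre_sum x y" by (rule module_fibre_sum)
  show ?thesis
    by (auto simp: coinvariant_relations_def intro!: X.minus_closed linear_map_closed[OF linear_map_fibre_act])
qed

abbreviation fibre_span :: "(('o \<times> 'g) \<times> ('o \<times> 'g) \<Rightarrow> 'm) set"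
  where "fibre_span \<equiv> span_of K (fibre_sum x y) (coinvariant_relations G (fibre_sum x y) (fibre_act x y))"

lemma fibre_span_submodule: "submodule fibre_span K (fibre_sum x y)"
  by (rule submodule_span_of[OF module_fibre_sum fibre_relations_closed])

lemma fibre_hom_eq: "fibre_hom x y = quotient_module (fibre_sum x y) fibre_span"
  by (simp add: quotient_hom_def coinvariants_def fibre_sum_def fibre_act_def)

lemma fibre_class_eq: "fibre_class x y s t f = fibre_span +>\<^bsub>fibre_sum x y\<^esub> fibre_summand x y s t f"
  by (simp add: quotient_class_def coinvariant_class_def fibre_sum_def fibre_act_def fibre_summand_def)

lemma module_fibre_hom: "module K (fibre_hom x y)"
  unfolding fibre_hom_eq by (rule module_quotient[OF module_fibre_sum fibre_span_submodule])

lemma linear_map_fibre_class: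
  assumes "s \<in> carrier G" "t \<in> carrier G"
  shows "linear_map K (Hom C x y) (fibre_hom x y) (fibre_class x y s t)"
  unfolding fibre_hom_eq fibre_class_eq
  by (rule linear_map_compose[OF linear_map_fibre_summand[OF assms]
        linear_map_quotient[OF module_fibre_sum fibre_span_submodule]])

text \<open>The two representatives differ by a defining relation of the coinvariants. With
  \<open>u\<close> the inverse of \<open>t\<close>, the target of any class can be moved to
  1.\<close>

lemma fibre_class_translate:
  assumes u: "u \<in> carrier G" and s: "s \<in> carrier G" and t: "t \<in> carrier G" and f: "f \<in> carrier (Hom C x y)"
  shows "fibre_class x y (u \<otimes>\<^bsub>G\<^esub> s) (u \<otimes>\<^bsub>G\<^esub> t) (act u x y f) = fibre_class x y s t f"
proof -
  have m: "fibre_summand x y s t f \<in> carrier (fibre_sum x y)"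
    by (rule linear_map_closed[OF linear_map_fibre_summand[OF s t] f])
  then have "fibre_act x y u (fibre_summand x y s t f) \<ominus>\<^bsub>fibre_sum x y\<^esub> fibre_summand x y s t f \<in> fibre_span"
    using u by (intro subsetD[OF span_of_superset]) (auto simp: coinvariant_relations_def)
  from coset_eqI[OF module_fibre_sum fibre_span_submodule linear_map_closed[OF linear_map_fibre_act[OF u] m] m this]
  show ?thesis
    by (simp add: fibre_class_eq fibre_act_summand[OF assms])
qed

lemma generates_fibre_hom:
  "generates K (fibre_hom x y) {fibre_class x y s t f |s t f. s \<in> carrier G \<and> t \<in> carrier G \<and> f \<in> carrier (Hom C x y)}"
proof -
  have "(\<lambda>\<Phi>. fibre_span +>\<^bsub>fibre_sum x y\<^esub> \<Phi>) `
      {fibre_summand x y s t f |s t f. s \<in> carrier G \<and> t \<in> carrier G \<and> f \<in> carrier (Hom C x y)} =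
      {fibre_class x y s t f |s t f. s \<in> carrier G \<and> t \<in> carrier G \<and> f \<in> carrier (Hom C x y)}"
    unfolding fibre_class_eq by blast
  then show ?thesis
    using generates_image[OF module_fibre_sum module_quotient[OF module_fibre_sum fibre_span_submodule]
        linear_map_quotient[OF module_fibre_sum fibre_span_submodule]
        quotient_module_carrier[OF module_fibre_sum fibre_span_submodule, symmetric] generates_fibre_sum]
    by (simp add: fibre_hom_eq)
qed

section \<open>Graded morphisms identified with coinvariants\<close>

definition graded_to_fibre :: "('g \<Rightarrow> 'm) \<Rightarrow> (('o \<times> 'g) \<times> ('o \<times> 'g) \<Rightarrow> 'm) set"
  where "graded_to_fibre = direct_sum_lift (fibre_hom x y) (carrier G) (\<lambda>_. Hom C x y)
    (\<lambda>u. fibre_class x y u \<one>\<^bsub>G\<^esub>)"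

lemma linear_map_graded_to_fibre: "linear_map K (graded_hom G C x y) (fibre_hom x y) graded_to_fibre"
  unfolding graded_to_fibre_def graded_hom_def
  by (rule linear_map_direct_sum_lift[OF hom_module[OF x y] module_fibre_hom linear_map_fibre_class]) auto

lemma graded_to_fibre_homogeneous:
  assumes "u \<in> carrier G" "f \<in> carrier (Hom C x y)"
  shows "graded_to_fibre (homogeneous G C x y u f) = fibre_class x y u \<one>\<^bsub>G\<^esub> f"
  unfolding graded_to_fibre_def homogeneous_def
  by (rule direct_sum_lift_summand[where M = "\<lambda>_. Hom C x y" and h = "\<lambda>u. fibre_class x y u \<one>\<^bsub>G\<^esub>",
        OF hom_module[OF x y] module_fibre_hom linear_map_fibre_class[OF _ one_closed] assms])

lemma fibre_class_normal_form:
  assumes s: "s \<in> carrier G" and t: "t \<in> carrier G" and f: "f \<in> carrier (Hom C x y)"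
  shows "fibre_class x y s t f =
    graded_to_fibre (homogeneous G C x y (inv\<^bsub>G\<^esub> t \<otimes>\<^bsub>G\<^esub> s) (act (inv\<^bsub>G\<^esub> t) x y f))"
  using fibre_class_translate[OF inv_closed[OF t] s t f] assms x y
  by (simp add: graded_to_fibre_homogeneous act_closed)

text \<open>The inverse must be defined on a quotient. The map \<open>\<theta>\<close> takes every
  component of the full sum to its normal form; it is constant along the action, hence kills the
  relations and descends.\<close>

lemma bij_betw_graded_to_fibre:
  "bij_betw graded_to_fibre (carrier (graded_hom G C x y)) (carrier (fibre_hom x y))"
proof -
  let ?M = "\<lambda>(b, a). Hom (inflated_category G C) a b"
  define h where "h = (\<lambda>(b :: 'o \<times> 'g, a :: 'o \<times> 'g) f. homogeneous G C x y (inv\<^bsub>G\<^esub> (snd b) \<otimes>\<^bsub>G\<^esub> snd a) (act (inv\<^bsub>G\<^esub> (snd b)) x y f))"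
  define \<theta> where "\<theta> = direct_sum_lift (graded_hom G C x y) (fibre y \<times> fibre x) ?M h"
  note D = module_graded_hom[OF x y]
  have h: "linear_map K (?M i) (graded_hom G C x y) (h i)" if "i \<in> fibre y \<times> fibre x" for i
    using that x y
    by (auto simp: h_def fibre_def intro!: linear_map_compose[OF act_linear linear_map_homogeneous])
  have \<theta>: "linear_map K (fibre_sum x y) (graded_hom G C x y) \<theta>"
    unfolding \<theta>_def fibre_sum_def orbit_sum_def
    by (rule linear_map_direct_sum_lift[OF module_fibre_components D h])
  have \<theta>s: "\<theta> (fibre_summand x y s t f) = homogeneous G C x y (inv\<^bsub>G\<^esub> t \<otimes>\<^bsub>G\<^esub> s) (act (inv\<^bsub>G\<^esub> t) x y f)"
    if "s \<in> carrier G" "t \<in> carrier G" "f \<in> carrier (Hom C x y)" for s t f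
    unfolding \<theta>_def fibre_summand_def
    by (subst direct_sum_lift_summand[where M = ?M and h = h, OF module_fibre_components D h])
      (use that in \<open>auto simp: fibre_def h_def\<close>)
  have inv: "\<theta> (fibre_act x y u \<Phi>) = \<theta> \<Phi>" if u: "u \<in> carrier G" and \<Phi>: "\<Phi> \<in> carrier (fibre_sum x y)" for u \<Phi>
  proof (rule linear_map_eq[where f = "\<lambda>\<Phi>. \<theta> (fibre_act x y u \<Phi>)" and g = \<theta>, OF generates_fibre_sum module_fibre_sum D
        linear_map_compose[OF linear_map_fibre_act[OF u] \<theta>] \<theta> _ \<Phi>])
    fix \<Psi> assume "\<Psi> \<in> {fibre_summand x y s t f |s t f. s \<in> carrier G \<and> t \<in> carrier G \<and> f \<in> carrier (Hom C x y)}"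
    then obtain s t f where \<Psi>: "\<Psi> = fibre_summand x y s t f"
      and st: "s \<in> carrier G" "t \<in> carrier G" "f \<in> carrier (Hom C x y)" by blast
    \<comment> \<open>Replacing \<open>s\<close>, \<open>t\<close>, \<open>f\<close> by their
      translates under \<open>u\<close> changes neither the degree nor the morphism of the normal
      form, because \<open>u\<close> cancels against the inverse of \<open>u t\<close> in
      both.\<close>
    have "inv\<^bsub>G\<^esub> (u \<otimes>\<^bsub>G\<^esub> t) \<otimes>\<^bsub>G\<^esub> (u \<otimes>\<^bsub>G\<^esub> s) = inv\<^bsub>G\<^esub> t \<otimes>\<^bsub>G\<^esub> s"
      using u st by (simp add: inv_mult_group m_assoc) (simp add: m_assoc[symmetric])
    moreover have "act (inv\<^bsub>G\<^esub> (u \<otimes>\<^bsub>G\<^esub> t)) x y (act u x y f) = act (inv\<^bsub>G\<^esub> t) x y f"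
      using u st x y by (simp add: inv_mult_group act_mult[symmetric] m_assoc)
    ultimately show "\<theta> (fibre_act x y u \<Psi>) = \<theta> \<Psi>"
      using u st x y by (simp add: \<Psi> fibre_act_summand \<theta>s act_closed)
  qed
  interpret D: module K "graded_hom G C x y" by (fact D)
  have kill: "\<Phi> \<in> carrier (fibre_sum x y) \<and> \<theta> \<Phi> = \<zero>\<^bsub>graded_hom G C x y\<^esub>"
    if \<Phi>: "\<Phi> \<in> coinvariant_relations G (fibre_sum x y) (fibre_act x y)" for \<Phi>
  proof -
    obtain u \<Psi> where u: "u \<in> carrier G" and \<Psi>: "\<Psi> \<in> carrier (fibre_sum x y)"
      and eq: "\<Phi> = fibre_act x y u \<Psi> \<ominus>\<^bsub>fibre_sum x y\<^esub> \<Psi>"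
      using \<Phi> by (auto simp: coinvariant_relations_def)
    have "\<theta> \<Phi> = \<theta> \<Psi> \<ominus>\<^bsub>graded_hom G C x y\<^esub> \<theta> \<Psi>"
      unfolding eq
      by (subst linear_map_minus[OF module_fibre_sum D \<theta> linear_map_closed[OF linear_map_fibre_act[OF u] \<Psi>] \<Psi>])
        (simp add: inv u \<Psi>)
    then show ?thesis
      using \<Phi> fibre_relations_closed linear_map_closed[OF \<theta> \<Psi>] by (auto simp: a_minus_def D.r_neg)
  qed
  have lift: "linear_map K (fibre_hom x y) (graded_hom G C x y) (quotient_lift \<theta>)"
    unfolding fibre_hom_eq by (rule linear_map_quotient_lift[OF module_fibre_sum D \<theta> kill])
  have lift_class: "quotient_lift \<theta> (fibre_class x y s t f) =
      homogeneous G C x y (inv\<^bsub>G\<^esub> t \<otimes>\<^bsub>G\<^esub> s) (act (inv\<^bsub>G\<^esub> t) x y f)"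
    if "s \<in> carrier G" "t \<in> carrier G" "f \<in> carrier (Hom C x y)" for s t f
    unfolding fibre_class_eq
    by (subst quotient_lift_coset[OF module_fibre_sum D \<theta> kill])
      (use that in \<open>auto simp: \<theta>s intro!: linear_map_closed[OF linear_map_fibre_summand]\<close>)
  show ?thesis
  proof (rule bij_betw_generators[OF D module_fibre_hom linear_map_graded_to_fibre lift
        generates_homogeneous[OF x y] _ generates_fibre_hom])
    show "quotient_lift \<theta> (graded_to_fibre \<Phi>) = \<Phi>"
      if "\<Phi> \<in> (\<Union>u\<in>carrier G. homogeneous G C x y u ` carrier (Hom C x y))" for \<Phi>
      using that x y by (auto simp: graded_to_fibre_homogeneous lift_class act_one)
    show "graded_to_fibre (quotient_lift \<theta> \<alpha>) = \<alpha>"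
      if "\<alpha> \<in> {fibre_class x y s t f |s t f. s \<in> carrier G \<and> t \<in> carrier G \<and> f \<in> carrier (Hom C x y)}" for \<alpha>
      using that by (auto simp: lift_class fibre_class_normal_form[symmetric])
  qed
qed

end

text \<open>The property behind the \<open>SOME\<close> speaks of arbitrary representatives, while
  the transported composition is known on images of graded morphisms. Normal forms for both
  arguments and for the result bridge the gap, so independence of representatives needs no separate
  argument.\<close>

lemma fibre_comp:
  assumes x: "x \<in> Obj C" and y: "y \<in> Obj C" and z: "z \<in> Obj C"
  shows "bilinear_map K (fibre_hom y z) (fibre_hom x y) (fibre_hom x z)
      (Comp (quotient_category K G (inflated_category G C) (inflated_action G C act)) (fibre x) (fibre y) (fibre z))"
      (is ?bil)
    and "\<lbrakk>f \<in> carrier (Hom C x y); g \<in> carrier (Hom C y z); u \<in> carrier G; v \<in> carrier G\<rbrakk> \<Longrightarrow>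
      Comp (quotient_category K G (inflated_category G C) (inflated_action G C act)) (fibre x) (fibre y) (fibre z)
        (fibre_class y z v \<one>\<^bsub>G\<^esub> g) (fibre_class x y u \<one>\<^bsub>G\<^esub> f) =
      fibre_class x z (v \<otimes>\<^bsub>G\<^esub> u) \<one>\<^bsub>G\<^esub> (Comp C x y z g (act v x y f))" (is "PROP ?val")
proof -
  let ?I = "inflated_category G C" and ?A = "inflated_action G C act"
  let ?P = "\<lambda>\<mu>. bilinear_map K (fibre_hom y z) (fibre_hom x y) (fibre_hom x z) \<mu> \<and>
       (\<forall>a\<in>fibre x. \<forall>b\<in>fibre y. \<forall>c\<in>fibre y. \<forall>d\<in>fibre z. \<forall>f\<in>carrier (Hom ?I a b). \<forall>g\<in>carrier (Hom ?I c d).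
         \<forall>s\<in>carrier G. c = act_obj ?A s b \<longrightarrow>
         \<mu> (quotient_class K G ?I ?A (fibre y) (fibre z) c d g) (quotient_class K G ?I ?A (fibre x) (fibre y) a b f) =
         quotient_class K G ?I ?A (fibre x) (fibre z) (act_obj ?A s a) d
           (Comp ?I (act_obj ?A s a) c d g (act_hom ?A s a b f)))"
  obtain \<mu> where \<mu>: "bilinear_map K (fibre_hom y z) (fibre_hom x y) (fibre_hom x z) \<mu>"
    and val: "\<And>\<Psi> \<Phi>. \<lbrakk>\<Psi> \<in> carrier (graded_hom G C y z); \<Phi> \<in> carrier (graded_hom G C x y)\<rbrakk> \<Longrightarrow>
      \<mu> (graded_to_fibre y z \<Psi>) (graded_to_fibre x y \<Phi>) = graded_to_fibre x z (Comp graded x y z \<Psi> \<Phi>)"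
    by (rule bilinear_map_transport[OF module_graded_hom[OF y z] module_fibre_hom[OF y z]
        linear_map_graded_to_fibre[OF y z] bij_betw_graded_to_fibre[OF y z]
        module_graded_hom[OF x y] module_fibre_hom[OF x y]
        linear_map_graded_to_fibre[OF x y] bij_betw_graded_to_fibre[OF x y]
        linear_map_graded_to_fibre[OF x z] graded_comp_bilinear[OF x y z]]) blast
  have "\<mu> (fibre_class y z (s \<otimes>\<^bsub>G\<^esub> t) r g) (fibre_class x y q t f) =
      fibre_class x z (s \<otimes>\<^bsub>G\<^esub> q) r (Comp C x y z g (act s x y f))"
    if g: "g \<in> carrier (Hom C y z)" and f: "f \<in> carrier (Hom C x y)" and s: "s \<in> carrier G"
      and qtr: "q \<in> carrier G" "t \<in> carrier G" "r \<in> carrier G" for g f s q t r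
  proof -
    \<comment> \<open>Cancels the intermediate label \<open>t\<close>. The instance
      \<open>w = q\<close> compares the degrees of the two composites, and \<open>w = 1\<close>
      compares the group elements that act on \<open>f\<close>.\<close>
    have mult: "inv\<^bsub>G\<^esub> r \<otimes>\<^bsub>G\<^esub> (s \<otimes>\<^bsub>G\<^esub> t) \<otimes>\<^bsub>G\<^esub> (inv\<^bsub>G\<^esub> t \<otimes>\<^bsub>G\<^esub> w) = inv\<^bsub>G\<^esub> r \<otimes>\<^bsub>G\<^esub> (s \<otimes>\<^bsub>G\<^esub> w)"
      if "w \<in> carrier G" for w
      using that s qtr by (simp add: m_assoc) (simp add: m_assoc[symmetric])
    have "act (inv\<^bsub>G\<^esub> r \<otimes>\<^bsub>G\<^esub> (s \<otimes>\<^bsub>G\<^esub> t)) x y (act (inv\<^bsub>G\<^esub> t) x y f) = act (inv\<^bsub>G\<^esub> r) x y (act s x y f)"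
      using mult[OF one_closed] s qtr f x y by (simp add: act_mult[symmetric])
    then have comp: "Comp C x y z (act (inv\<^bsub>G\<^esub> r) y z g)
          (act (inv\<^bsub>G\<^esub> r \<otimes>\<^bsub>G\<^esub> (s \<otimes>\<^bsub>G\<^esub> t)) x y (act (inv\<^bsub>G\<^esub> t) x y f)) =
        act (inv\<^bsub>G\<^esub> r) x z (Comp C x y z g (act s x y f))"
      using s qtr f g x y z by (simp add: act_comp act_closed)
    show ?thesis
      using s qtr f g x y z
      by (simp add: fibre_class_normal_form val homogeneous_closed act_closed comp_closed
          graded_comp_homogeneous mult comp)
  qed
  with \<mu> x y z have "?P \<mu>"
    by (auto simp: fibre_def)
  then have P: "?P (Comp (quotient_category K G ?I ?A) (fibre x) (fibre y) (fibre z))"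
    by (rule eq_Eps_imp[where P = ?P, rotated]) (simp add: quotient_category_def)
  then show ?bil
    by (rule conjunct1)
  show "PROP ?val"
  proof -
    assume f: "f \<in> carrier (Hom C x y)" and g: "g \<in> carrier (Hom C y z)"
      and u: "u \<in> carrier G" and v: "v \<in> carrier G"
    \<comment> \<open>The defining property is used with \<open>s = v\<close>, the element that
      carries the target \<open>(y, 1)\<close> of \<open>f\<close> to the source
      \<open>(y, v)\<close> of \<open>g\<close>.\<close>
    have "(x, u) \<in> fibre x" "(y, \<one>\<^bsub>G\<^esub>) \<in> fibre y" "(y, v) \<in> fibre y" "(z, \<one>\<^bsub>G\<^esub>) \<in> fibre z"
      "f \<in> carrier (Hom ?I (x, u) (y, \<one>\<^bsub>G\<^esub>))" "g \<in> carrier (Hom ?I (y, v) (z, \<one>\<^bsub>G\<^esub>))"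
      "(y, v) = act_obj ?A v (y, \<one>\<^bsub>G\<^esub>)"
      using f g u v y by (simp_all add: fibre_def)
    note val = P[THEN conjunct2, THEN bspec, OF this(1), THEN bspec, OF this(2), THEN bspec, OF this(3),
        THEN bspec, OF this(4), THEN bspec, OF this(5), THEN bspec, OF this(6), THEN bspec, OF v,
        THEN mp, OF this(7)]
    show "Comp (quotient_category K G ?I ?A) (fibre x) (fibre y) (fibre z)
        (fibre_class y z v \<one>\<^bsub>G\<^esub> g) (fibre_class x y u \<one>\<^bsub>G\<^esub> f) =
      fibre_class x z (v \<otimes>\<^bsub>G\<^esub> u) \<one>\<^bsub>G\<^esub> (Comp C x y z g (act v x y f))"
      using val u x by simp
  qed
qed

text \<open>The definition picks an unknown object \<open>(x, s)\<close> of the orbit. It is the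
  translate of \<open>(x, 1)\<close> by \<open>s\<close>, and \<open>s\<close> fixes the identity of
  \<open>x\<close>, so the class is the same.\<close>

lemma fibre_ident:
  assumes x: "x \<in> Obj C"
  shows "Ident (quotient_category K G (inflated_category G C) (inflated_action G C act)) (fibre x) =
    fibre_class x x \<one>\<^bsub>G\<^esub> \<one>\<^bsub>G\<^esub> (Ident C x)"
proof -
  let ?a = "SOME a. a \<in> fibre x"
  have "(x, \<one>\<^bsub>G\<^esub>) \<in> fibre x"
    by (simp add: fibre_def)
  then have "?a \<in> fibre x"
    by (rule someI)
  then obtain s where s: "s \<in> carrier G" and a: "?a = (x, s)"
    by (auto simp: fibre_def)
  have "fibre_class x x s s (Ident C x) = fibre_class x x \<one>\<^bsub>G\<^esub> \<one>\<^bsub>G\<^esub> (Ident C x)"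
    using fibre_class_translate[OF x x s one_closed one_closed ident_closed[OF x]] s x by (simp add: act_ident)
  then show ?thesis
    by (simp add: quotient_category_def Let_def a)
qed

definition graded_to_quotient ::
    "('o, 'g \<Rightarrow> 'm, ('o \<times> 'g) set, (('o \<times> 'g) \<times> ('o \<times> 'g) \<Rightarrow> 'm) set) kfunctor"
  where "graded_to_quotient = \<lparr>on_obj = fibre, on_hom = graded_to_fibre\<rparr>"

lemma quotient_isomorphism:
  shows k_category_quotient:
      "k_category K (quotient_category K G (inflated_category G C) (inflated_action G C act))"
    and graded_to_quotient_isomorphism:
      "k_isomorphism K graded (quotient_category K G (inflated_category G C) (inflated_action G C act))
        graded_to_quotient"
proof -
  let ?E = "quotient_category K G (inflated_category G C) (inflated_action G C act)"
  have [simp]: "on_obj graded_to_quotient = fibre" "on_hom graded_to_quotient = graded_to_fibre"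
    "Obj ?E = fibre ` Obj C"
    "Hom ?E = quotient_hom K G (inflated_category G C) (inflated_action G C act)"
    using orbits_inflated by (simp_all add: graded_to_quotient_def quotient_category_def)
  \<comment> \<open>Fibres are nonempty because \<open>G\<close> contains 1, so a fibre determines
    its object.\<close>
  have "inj_on fibre (Obj C)"
    using one_closed by (auto simp: inj_on_def fibre_def)
  then have bij: "bij_betw fibre (Obj C) (fibre ` Obj C)"
    by (simp add: bij_betw_def)
  note facts = bij module_fibre_hom fibre_comp fibre_ident linear_map_graded_to_fibre
    bij_betw_graded_to_fibre graded_to_fibre_homogeneous comp_closed act_closed ident_closed
  show "k_category K ?E"
    by (rule graded_isomorphismI(1)[of graded_to_quotient]) (auto simp: facts)
  show "k_isomorphism K graded ?E graded_to_quotient"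
    by (rule graded_isomorphismI(2)) (auto simp: facts)
qed

section \<open>The two equivalences\<close>

lemma quotient_equivalent_smash:
  "k_equivalent K (quotient_category K G (inflated_category G C) (inflated_action G C act))
    (smash_category K G C act)"
proof -
  obtain H where "k_isomorphism K (quotient_category K G (inflated_category G C) (inflated_action G C act)) graded H"
    by (rule k_isomorphism_inverse[OF k_category_graded k_category_quotient graded_to_quotient_isomorphism])
  from k_isomorphism_compose[OF this graded_to_smash_isomorphism] show ?thesis
    by (rule k_isomorphism_imp_equivalent[OF k_category_quotient k_category_smash])
qed

text \<open>One functor forgets the label of an object, the other inserts the label 1. Starting from
  \<open>C\<close> their composite changes nothing; starting from the inflated category it replaces
  \<open>(x, s)\<close> by \<open>(x, 1)\<close>, an isomorphic object.\<close>

lemma inflated_equivalent: "k_equivalent K (inflated_category G C) C"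
proof -
  let ?I = "inflated_category G C"
  let ?F = "\<lparr>on_obj = fst, on_hom = (\<lambda>_ _ f. f)\<rparr> :: ('o \<times> 'g, 'm, 'o, 'm) kfunctor"
  let ?H = "\<lparr>on_obj = (\<lambda>x. (x, \<one>\<^bsub>G\<^esub>)), on_hom = (\<lambda>_ _ f. f)\<rparr> :: ('o, 'm, 'o \<times> 'g, 'm) kfunctor"
  have "k_functor K ?I C ?F" "k_functor K C ?I ?H"
    by (auto simp: k_functor_def linear_map_id)
  moreover have "naturally_isomorphic ?I ?I (comp_functor ?H ?F) id_functor"
    unfolding naturally_isomorphic_def
    \<comment> \<open>The identity of \<open>x\<close> is read as a morphism from
      \<open>(x, 1)\<close> to \<open>(x, s)\<close>; its inverse is the same morphism of
      \<open>C\<close> read in the other direction.\<close>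
    by (rule exI[of _ "\<lambda>(x, s). Ident C x"])
      (auto simp: comp_functor_def id_functor_def isomorphism_def ident_closed ident_left ident_right)
  moreover have "naturally_isomorphic C C (comp_functor ?F ?H) id_functor"
    by (rule naturally_isomorphic_identI[OF k_category_axioms])
      (auto simp: comp_functor_def id_functor_def)
  ultimately show ?thesis
    using inflated_k_category k_category_axioms unfolding k_equivalent_def by blast
qed

end

theorem theorem4p10:
  fixes K :: "('k, 'r) ring_scheme"
    and G :: "('g, 's) monoid_scheme"
    and C :: "('k, 'o, 'm) kcat"
    and act :: "'g \<Rightarrow> 'o \<Rightarrow> 'o \<Rightarrow> 'm \<Rightarrow> 'm"
    and B :: "('k, 'o, ('m \<times> ('g \<Rightarrow> 'k) \<Rightarrow> 'k) set) kcat"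
    and S :: "('o, 'm, 'o, ('m \<times> ('g \<Rightarrow> 'k) \<Rightarrow> 'k) set) kfunctor"
    and E :: "('k, ('o \<times> 'g) set, (('o \<times> 'g) \<times> ('o \<times> 'g) \<Rightarrow> 'm) set) kcat"
    and P :: "('o \<times> 'g, 'm, ('o \<times> 'g) set, (('o \<times> 'g) \<times> ('o \<times> 'g) \<Rightarrow> 'm) set) kfunctor"
  assumes "field K"
    and "group G" and "finite (carrier G)"
    and "smash_extension K G C act B S"
    and "E = quotient_category K G (inflated_category G C) (inflated_action G C act)"
    and "P = galois_projection K G (inflated_category G C) (inflated_action G C act)"
  shows "k_equivalent K (inflated_category G C) C \<and> k_equivalent K E B"
proof -
  interpret kG_module_category K G C act
    using assms(4) by (simp add: smash_extension_def)
  show ?thesis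
    using inflated_equivalent quotient_equivalent_smash assms(4,5) by (simp add: smash_extension_def)
qed

end
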